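(* Let $U(x,y)$ be a solution to the Liouville equation $$U_{xx}+U_{yy}+2e^{U}=0.$$ Then $$x^0=\tfrac1{16}\big((1+x^2+y^2)(U_x^2+U_y^2)+8(xU_x+yU_y)+16\big)e^{-U/2}+\tfrac14(1+x^2+y^2)e^{U/2},$$ $$x^1=-\tfrac18\big(x(U_x^2+U_y^2)+4U_x\big)e^{-U/2}-\tfrac12 x\,e^{U/2},$$ $$x^2=\tfrac18\big(y(U_x^2+U_y^2)+4U_y\big)e^{-U/2}+\tfrac12 y\,e^{U/2},$$ $$x^3=\tfrac1{16}\big((1-x^2-y^2)(U_x^2+U_y^2)-8(xU_x+yU_y)-16\big)e^{-U/2}+\tfrac14(1-x^2-y^2)e^{U/2}$$ defines an immersed CMC-1 hypersurface (surface of constant mean curvature one) in $\mathrm{H}^3$. Conversely, an immersed CMC-1 surface in $\mathrm{H}^3$ can be written locally as the image of a solution $U$ to the Liouville equation under the map given by these formulas.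
   Context: On the left-hand sides, $x^0,x^1,x^2,x^3$ are the coordinates of $\mathbb{R}^4$ (superscripts are indices); on the right-hand sides $x,y$ are the independent variables of $U$, and $x^2,y^2$ are their squares. Hyperbolic 3-space is $\mathrm{H}^3=\{(x^0,x^1,x^2,x^3)\in\mathbb{R}^4: (x^0)^2-(x^1)^2-(x^2)^2-(x^3)^2=1,\ x^0>0\}$, with the Riemannian metric of constant sectional curvature $-1$ given by restricting the Minkowski quadratic form $-(dx^0)^2+(dx^1)^2+(dx^2)^2+(dx^3)^2$, whose associated inner product is denoted $\langle\,,\rangle$. For an immersed oriented surface $s:M\to\mathrm{H}^3$ with oriented unit normal $N:M\to\mathbb{R}^4$ (tangent to $\mathrm{H}^3$, of unit length, orthogonal to the surface), the second fundamental form is $h=-\langle dN,ds\rangle$ and the mean curvature is $\frac12\operatorname{tr}h$, the trace being taken with respect to the induced metric. CMC-1 means that the mean curvature is identically $1$.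
   Formalization: Immersed CMC-1 surface is claimed exactly where U_zz − U_z²/2 ≠ 0 (z=x+iy; the map can be constant otherwise); the converse is claimed at non-umbilic points whose hyperbolic Gauss image is not the ideal point of (1,0,0,−1), or at any non-umbilic point up to an isometry of H³. *)

theory Defs
  imports "HOL-Analysis.Analysis"
begin

section \<open>Smooth maps on open subsets of the plane\<close>

definition pd :: "2 \<Rightarrow> (real^2 \<Rightarrow> 'a::real_normed_vector) \<Rightarrow> real^2 \<Rightarrow> 'a"
  where "pd i f p = frechet_derivative f (at p) (axis i 1)"

primrec Ck_on :: "nat \<Rightarrow> (real^2) set \<Rightarrow> (real^2 \<Rightarrow> 'a::real_normed_vector) \<Rightarrow> bool"
  where
    "Ck_on 0 S f \<longleftrightarrow> continuous_on S f"
  | "Ck_on (Suc k) S f \<longleftrightarrow> (\<forall>p\<in>S. f differentiable (at p)) \<and> (\<forall>i. Ck_on k S (pd i f))"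

text \<open>Only meant for open \<open>S\<close>: the derivatives are taken at \<open>p\<close> and not within \<open>S\<close>.\<close>

definition smooth_on :: "(real^2) set \<Rightarrow> (real^2 \<Rightarrow> 'a::real_normed_vector) \<Rightarrow> bool"
  where "smooth_on S f \<longleftrightarrow> (\<forall>k. Ck_on k S f)"

definition diffeo_betw :: "(real^2 \<Rightarrow> real^2) \<Rightarrow> (real^2) set \<Rightarrow> (real^2) set \<Rightarrow> bool"
  where "diffeo_betw \<phi> V W \<longleftrightarrow>
    open V \<and> open W \<and> bij_betw \<phi> V W \<and> smooth_on V \<phi> \<and> smooth_on W (inv_into V \<phi>)"

section \<open>Hyperbolic space\<close>

text \<open>The elements of the index type \<open>4\<close> are \<open>0, 1, 2, 3\<close> (with \<open>4 = 0\<close>), so that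
  \<open>v $ 0\<close>, \<dots>, \<open>v $ 3\<close> are the coordinates \<open>x\<^sup>0\<close>, \<dots>, \<open>x\<^sup>3\<close>.\<close>

definition vec4 :: "real \<Rightarrow> real \<Rightarrow> real \<Rightarrow> real \<Rightarrow> real^4"
  where "vec4 a b c d = (\<chi> i. if i = 0 then a else if i = 1 then b else if i = 2 then c else d)"

definition mink :: "real^4 \<Rightarrow> real^4 \<Rightarrow> real"
  where "mink v w = - (v$0 * w$0) + v$1 * w$1 + v$2 * w$2 + v$3 * w$3"

definition H3 :: "(real^4) set"
  where "H3 = {v. (v$0)\<^sup>2 - (v$1)\<^sup>2 - (v$2)\<^sup>2 - (v$3)\<^sup>2 = 1 \<and> v$0 > 0}"

definition H3_isometry :: "(real^4 \<Rightarrow> real^4) \<Rightarrow> bool"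
  where "H3_isometry L \<longleftrightarrow>
    linear L \<and> (\<forall>v w. mink (L v) (L w) = mink v w) \<and> L ` H3 = H3"

section \<open>Immersed surfaces and their mean curvature\<close>

text \<open>A surface is given in a coordinate chart, the open set \<open>M\<close> of the plane. Orienting it
  amounts to choosing one of the two unit normal fields, so an oriented surface
  is a pair \<open>s\<close>, \<open>N\<close>.\<close>

definition immersive_at :: "(real^2 \<Rightarrow> real^4) \<Rightarrow> real^2 \<Rightarrow> bool"
  where "immersive_at s p \<longleftrightarrow> s differentiable (at p) \<and> inj (frechet_derivative s (at p))"

definition immersed_surface ::
    "(real^2) set \<Rightarrow> (real^2 \<Rightarrow> real^4) \<Rightarrow> (real^2 \<Rightarrow> real^4) \<Rightarrow> bool"
  where "immersed_surface M s N \<longleftrightarrow>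
    open M \<and> smooth_on M s \<and> s ` M \<subseteq> H3 \<and> (\<forall>p\<in>M. immersive_at s p) \<and>
    smooth_on M N \<and>
    (\<forall>p\<in>M. mink (N p) (N p) = 1 \<and> mink (N p) (s p) = 0 \<and> (\<forall>i. mink (N p) (pd i s p) = 0))"

definition first_form :: "(real^2 \<Rightarrow> real^4) \<Rightarrow> real^2 \<Rightarrow> real^2^2"
  where "first_form s p = (\<chi> i j. mink (pd i s p) (pd j s p))"

definition second_form :: "(real^2 \<Rightarrow> real^4) \<Rightarrow> (real^2 \<Rightarrow> real^4) \<Rightarrow> real^2 \<Rightarrow> real^2^2"
  where "second_form s N p = (\<chi> i j. - mink (pd i N p) (pd j s p))"

definition mean_curvature :: "(real^2 \<Rightarrow> real^4) \<Rightarrow> (real^2 \<Rightarrow> real^4) \<Rightarrow> real^2 \<Rightarrow> real"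
  where "mean_curvature s N p = trace (matrix_inv (first_form s p) ** second_form s N p) / 2"

definition CMC1_surface ::
    "(real^2) set \<Rightarrow> (real^2 \<Rightarrow> real^4) \<Rightarrow> (real^2 \<Rightarrow> real^4) \<Rightarrow> bool"
  where "CMC1_surface M s N \<longleftrightarrow>
    immersed_surface M s N \<and> (\<forall>p\<in>M. mean_curvature s N p = 1)"

definition umbilic :: "(real^2 \<Rightarrow> real^4) \<Rightarrow> (real^2 \<Rightarrow> real^4) \<Rightarrow> real^2 \<Rightarrow> bool"
  where "umbilic s N p \<longleftrightarrow> (\<exists>c. second_form s N p = c *\<^sub>R first_form s p)"

text \<open>The hyperbolic Gauss map sends \<open>p\<close> to the ideal point of hyperbolic space spanned by the
  null vector \<open>s p + N p\<close>. The ideal points are the lines through the null vectors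
  \<open>vec4 ((1+x^2+y^2)/2) (-x) y ((1-x^2-y^2)/2)\<close> and the line through \<open>vec4 1 0 0 (-1)\<close>,
  which is the one at infinity with respect to \<open>x, y\<close>.\<close>

definition gauss_at_infinity :: "(real^2 \<Rightarrow> real^4) \<Rightarrow> (real^2 \<Rightarrow> real^4) \<Rightarrow> real^2 \<Rightarrow> bool"
  where "gauss_at_infinity s N p \<longleftrightarrow> (\<exists>c. s p + N p = c *\<^sub>R vec4 1 0 0 (-1))"

section \<open>The Liouville equation and the associated map\<close>

definition liouville_solution :: "(real^2) set \<Rightarrow> (real^2 \<Rightarrow> real) \<Rightarrow> bool"
  where "liouville_solution D U \<longleftrightarrow>
    open D \<and> smooth_on D U \<and>
    (\<forall>p\<in>D. pd 1 (pd 1 U) p + pd 2 (pd 2 U) p + 2 * exp (U p) = 0)"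

definition liouville_map :: "(real^2 \<Rightarrow> real) \<Rightarrow> real^2 \<Rightarrow> real^4"
  where "liouville_map U p =
    (let x = p$1; y = p$2; Ux = pd 1 U p; Uy = pd 2 U p in
     vec4
       (1/16 * ((1 + x^2 + y^2) * (Ux^2 + Uy^2) + 8 * (x * Ux + y * Uy) + 16) * exp (- U p / 2)
          + 1/4 * (1 + x^2 + y^2) * exp (U p / 2))
       (- 1/8 * (x * (Ux^2 + Uy^2) + 4 * Ux) * exp (- U p / 2) - 1/2 * x * exp (U p / 2))
       (1/8 * (y * (Ux^2 + Uy^2) + 4 * Uy) * exp (- U p / 2) + 1/2 * y * exp (U p / 2))
       (1/16 * ((1 - x^2 - y^2) * (Ux^2 + Uy^2) - 8 * (x * Ux + y * Uy) - 16) * exp (- U p / 2)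
          + 1/4 * (1 - x^2 - y^2) * exp (U p / 2)))"

text \<open>With \<open>z = x + i y\<close>, the following is the vanishing of the real and imaginary parts of
  \<open>4 (U\<^sub>z\<^sub>z - U\<^sub>z^2 / 2)\<close>. At such points the derivative of the map vanishes. There are solutions
  for which this happens everywhere: for \<open>U = ln (4 / (1+x^2+y^2)^2)\<close> the map is constant.\<close>

definition degenerate_at :: "(real^2 \<Rightarrow> real) \<Rightarrow> real^2 \<Rightarrow> bool"
  where "degenerate_at U p \<longleftrightarrow>
    pd 1 (pd 1 U) p - pd 2 (pd 2 U) p = ((pd 1 U p)\<^sup>2 - (pd 2 U p)\<^sup>2) / 2 \<and>
    2 * pd 1 (pd 2 U) p = pd 1 U p * pd 2 U p"

text \<open>Near \<open>p\<close>, the surface \<open>s\<close> is the image of a solution, up to a change of parameters.\<close>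

definition locally_liouville :: "(real^2) set \<Rightarrow> (real^2 \<Rightarrow> real^4) \<Rightarrow> real^2 \<Rightarrow> bool"
  where "locally_liouville M s p \<longleftrightarrow>
    (\<exists>V D U \<phi>. p \<in> V \<and> V \<subseteq> M \<and> diffeo_betw \<phi> V D \<and> liouville_solution D U \<and>
       (\<forall>q\<in>V. s q = liouville_map U (\<phi> q)))"

end

(* The null vectors n = null_lift parametrise the ideal boundary of H3 up to a point, and n, its derivatives
and the null vector null_inf frame Minkowski space. In this frame the Liouville map s satisfies
<s, s> = -1, <s, n> = -exp(-U/2), and s is orthogonal to the derivatives of exp(U/2) n; these
conditions determine s. Hence N = exp(U/2) n - s is a unit normal, that is, exp(U/2) n is the
hyperbolic Gauss map s + N. With H = liouville_hess U, the pairing <d(s + N), ds> = I - II is H/2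
and I is exp(-U)/4 H^2, so the mean curvature is 1 iff tr(H^-1) = 0 iff tr H = 0, which is the
Liouville equation.
Conversely, at a non-umbilic point of a CMC-1 surface the form I - II is nondegenerate, so the
direction of the null vector s + N is a local coordinate. Writing s + N = exp(U/2) n in this
coordinate defines U, and the conditions above force s to be the Liouville map of U. A
reflection moves the Gauss image away from the point at infinity. *)

theory Submission
  imports Defs
begin

section \<open>Calculus of smooth maps on the plane\<close>

text \<open>Geometrically, the points \<open>v\<close> of \<open>H3\<close> whose pairing with
  exp(U/2) n is -1 form a horosphere, and the conditions on s say that s is the envelope of these
  horospheres as x and y vary; the formulas of the theorem solve the envelope equations. In
  dimension two tr(H^-1) = tr H / det H, and this alone turns a fully nonlinear curvature condition
  into the Liouville equation. It also leaves no intermediate rank: a symmetric trace-free H is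
  invertible or zero, so the map fails to be immersive only where its whole derivative vanishes. At
  an umbilic point of a CMC-1 surface I = II and the derivative of s + N vanishes, as it does
  everywhere on a horosphere, so the Gauss map gives no coordinate there. A given surface comes in
  arbitrary parameters while the formulas live in Gauss coordinates; the curvature computation
  therefore carries a Jacobian and serves both directions. Smoothness is defined by iterated partial
  derivatives, so closure properties are inductions on the order, and the local inverse has to be
  bootstrapped to all orders.\<close>

lemma pd_eqI: "(f has_derivative f') (at p) \<Longrightarrow> pd i f p = f' (axis i 1)"
  unfolding pd_def using frechet_derivative_at by metis

lemma vec2_expand: "(h::real^2) = h$1 *\<^sub>R axis 1 1 + h$2 *\<^sub>R axis 2 1"
  by (simp add: vec_eq_iff forall_2 axis_def)

lemma has_derivative_pd:
  assumes "f differentiable (at p)"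
  shows "(f has_derivative (\<lambda>h. h$1 *\<^sub>R pd 1 f p + h$2 *\<^sub>R pd 2 f p)) (at p)"
proof -
  let ?D = "frechet_derivative f (at p)"
  have lin: "linear ?D" using assms by (rule linear_frechet_derivative)
  have "?D h = h$1 *\<^sub>R pd 1 f p + h$2 *\<^sub>R pd 2 f p" for h
    using arg_cong[OF vec2_expand[of h], of ?D]
    by (simp add: linear_add[OF lin] linear_scale[OF lin] pd_def)
  then have "?D = (\<lambda>h. h$1 *\<^sub>R pd 1 f p + h$2 *\<^sub>R pd 2 f p)" by (rule ext)
  then show ?thesis using assms frechet_derivative_works by metis
qed

lemma pd_cong_open:
  assumes "open S" "p \<in> S" "\<And>x. x \<in> S \<Longrightarrow> f x = g x"
  shows "pd i f p = pd i g p"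
proof -
  have "(f has_derivative D) (at p) \<longleftrightarrow> (g has_derivative D) (at p)" for D
    using has_derivative_transform_within_open[of f D p UNIV S g]
      has_derivative_transform_within_open[of g D p UNIV S f] assms by auto
  then show ?thesis by (simp add: pd_def frechet_derivative_def)
qed

lemma differentiable_cong_open:
  assumes "open S" "p \<in> S" "\<And>x. x \<in> S \<Longrightarrow> f x = g x" "f differentiable (at p)"
  shows "g differentiable (at p)"
  using assms has_derivative_transform_within_open[of f _ p UNIV S g]
  unfolding differentiable_def by blast

section \<open>Closure properties of the classes C^k\<close>

lemma Ck_on_cong:
  assumes "open S" "\<And>x. x \<in> S \<Longrightarrow> f x = g x"
  shows "Ck_on k S f \<longleftrightarrow> Ck_on k S g"
  using assms(2)
proof (induction k arbitrary: f g)
  case 0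
  then show ?case using continuous_on_cong[of S S f g] by simp
next
  case (Suc k)
  have "Ck_on k S (pd i f) \<longleftrightarrow> Ck_on k S (pd i g)" for i
    by (rule Suc.IH) (use pd_cong_open[OF assms(1)] Suc.prems in blast)
  moreover have "f differentiable (at p) \<longleftrightarrow> g differentiable (at p)" if "p \<in> S" for p
    using differentiable_cong_open[OF assms(1) that, of f g]
      differentiable_cong_open[OF assms(1) that, of g f] Suc.prems by metis
  ultimately show ?case by simp
qed

lemma Ck_on_SucD: "Ck_on (Suc k) S f \<Longrightarrow> Ck_on k S f"
proof (induction k arbitrary: f)
  case 0
  then show ?case
    by (auto intro!: continuous_at_imp_continuous_on differentiable_imp_continuous_within)
next
  case (Suc k)
  then show ?case by (metis Ck_on.simps(2))
qed

lemma Ck_on_subset: "Ck_on k S f \<Longrightarrow> S' \<subseteq> S \<Longrightarrow> Ck_on k S' f"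
  by (induction k arbitrary: f) (auto intro: continuous_on_subset)

lemma Ck_on_const: "Ck_on k S (\<lambda>_. c)"
proof (induction k arbitrary: c)
  case (Suc k)
  have "pd i (\<lambda>_. c) = (\<lambda>_. 0)" for i by (simp add: pd_def fun_eq_iff)
  then show ?case using Suc by simp
qed simp

text \<open>Lets the inductions below exhibit a derivative by the usual rules and check it on the
  two axis vectors, instead of computing \<open>pd\<close>.\<close>

lemma Ck_on_SucI:
  assumes "open S" "\<And>p. p \<in> S \<Longrightarrow> (f has_derivative D p) (at p)"
    and "\<And>i. Ck_on k S (\<lambda>p. D p (axis i 1))"
  shows "Ck_on (Suc k) S f"
proof -
  have "Ck_on k S (pd i f)" for i
    using Ck_on_cong[OF assms(1), of "pd i f" "\<lambda>p. D p (axis i 1)" k] pd_eqI[OF assms(2)] assms(3)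
    by blast
  then show ?thesis using assms(2) by (auto simp: differentiable_def)
qed

lemma Ck_on_Suc_derivative:
  "Ck_on (Suc k) S f \<Longrightarrow> p \<in> S \<Longrightarrow> (f has_derivative frechet_derivative f (at p)) (at p)"
  by (simp add: frechet_derivative_works)

lemma Ck_on_Suc_pd: "Ck_on (Suc k) S f \<Longrightarrow> Ck_on k S (pd i f)"
  by simp

lemma Ck_on_add:
  assumes "open S" "Ck_on k S f" "Ck_on k S g"
  shows "Ck_on k S (\<lambda>x. f x + g x)"
  using assms(2,3)
proof (induction k arbitrary: f g)
  case 0
  then show ?case by (simp add: continuous_on_add)
next
  case (Suc k)
  show ?case
    using Suc.IH[OF Suc.prems[THEN Ck_on_Suc_pd]]
    by (intro Ck_on_SucI[OF assms(1) has_derivative_add[OF Suc.prems[THEN Ck_on_Suc_derivative]]])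
      (simp_all add: pd_def[symmetric])
qed

lemma Ck_on_linear:
  assumes "open S" "bounded_linear L" "Ck_on k S f"
  shows "Ck_on k S (\<lambda>x. L (f x))"
  using assms(3)
proof (induction k arbitrary: f)
  case 0
  then show ?case by (simp add: bounded_linear.continuous_on[OF assms(2)])
next
  case (Suc k)
  show ?case
    using Suc.IH[OF Suc.prems[THEN Ck_on_Suc_pd]]
    by (intro Ck_on_SucI[OF assms(1)
          bounded_linear.has_derivative[OF assms(2) Suc.prems[THEN Ck_on_Suc_derivative]]])
      (simp_all add: pd_def[symmetric])
qed

lemma Ck_on_bilinear:
  assumes "open S" "bounded_bilinear prd" "Ck_on k S f" "Ck_on k S g"
  shows "Ck_on k S (\<lambda>x. prd (f x) (g x))"
  using assms(3,4)
proof (induction k arbitrary: f g)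
  case 0
  then show ?case by (simp add: bounded_bilinear.continuous_on[OF assms(2)])
next
  case (Suc k)
  have "Ck_on k S (\<lambda>x. prd (f x) (pd i g x) + prd (pd i f x) (g x))" for i
    by (intro Ck_on_add assms(1) Suc.IH Suc.prems[THEN Ck_on_Suc_pd] Suc.prems[THEN Ck_on_SucD])
  then show ?case
    by (intro Ck_on_SucI[OF assms(1)
          bounded_bilinear.FDERIV[OF assms(2) Suc.prems[THEN Ck_on_Suc_derivative]]])
      (simp_all add: pd_def[symmetric])
qed

text \<open>By the chain rule a partial derivative of the composite is a sum of products of
  derivatives of \<phi> with \<open>pd 1 f\<close> and \<open>pd 2 f\<close> at \<phi>; so the
  induction varies \<open>f\<close> while \<phi> stays fixed.\<close>

lemma Ck_on_compose:
  fixes \<phi> :: "real^2 \<Rightarrow> real^2"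
  assumes "open S" "\<phi> ` S \<subseteq> T" "Ck_on k S \<phi>" "Ck_on k T f"
  shows "Ck_on k S (\<lambda>x. f (\<phi> x))"
  using assms(3,4)
proof (induction k arbitrary: f)
  case 0
  then show ?case using continuous_on_compose2[of T f S \<phi>] assms(2) by simp
next
  case (Suc k)
  have der: "((\<lambda>x. f (\<phi> x)) has_derivative
      (\<lambda>h. (frechet_derivative \<phi> (at p) h)$1 *\<^sub>R pd 1 f (\<phi> p)
         + (frechet_derivative \<phi> (at p) h)$2 *\<^sub>R pd 2 f (\<phi> p))) (at p)"
    if "p \<in> S" for p
    by (rule has_derivative_compose[OF Ck_on_Suc_derivative[OF Suc.prems(1) that] has_derivative_pd])
      (use Suc.prems that assms(2) in auto)
  note nth = Ck_on_linear[OF assms(1) bounded_linear_vec_nth Ck_on_Suc_pd[OF Suc.prems(1)]]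
  note comp = Suc.IH[OF Ck_on_SucD[OF Suc.prems(1)] Ck_on_Suc_pd[OF Suc.prems(2)]]
  have "Ck_on k S (\<lambda>x. pd i \<phi> x $ 1 *\<^sub>R pd 1 f (\<phi> x) + pd i \<phi> x $ 2 *\<^sub>R pd 2 f (\<phi> x))" for i
    by (intro Ck_on_add assms(1) Ck_on_bilinear[OF assms(1) bounded_bilinear_scaleR] nth comp)
  then show ?case
    by (intro Ck_on_SucI[OF assms(1) der]) (simp_all add: pd_def[symmetric])
qed

section \<open>Smooth maps\<close>

lemma smooth_on_iff:
  "smooth_on S f \<longleftrightarrow> (\<forall>p\<in>S. f differentiable (at p)) \<and> (\<forall>i. smooth_on S (pd i f))"
proof
  assume "smooth_on S f"
  then have "Ck_on (Suc k) S f" for k by (simp only: smooth_on_def)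
  then show "(\<forall>p\<in>S. f differentiable (at p)) \<and> (\<forall>i. smooth_on S (pd i f))"
    by (simp add: smooth_on_def)
next
  assume "(\<forall>p\<in>S. f differentiable (at p)) \<and> (\<forall>i. smooth_on S (pd i f))"
  then have "Ck_on (Suc k) S f" for k by (simp add: smooth_on_def)
  then show "smooth_on S f" unfolding smooth_on_def using Ck_on_SucD by blast
qed

lemma smooth_on_pd: "smooth_on S f \<Longrightarrow> smooth_on S (pd i f)"
  using smooth_on_iff by blast

lemma smooth_on_differentiable: "smooth_on S f \<Longrightarrow> p \<in> S \<Longrightarrow> f differentiable (at p)"
  using smooth_on_iff by blast

lemma smooth_on_continuous: "smooth_on S f \<Longrightarrow> continuous_on S f"
  by (metis Ck_on.simps(1) smooth_on_def)

lemma smooth_on_has_derivative: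
  "smooth_on S f \<Longrightarrow> p \<in> S \<Longrightarrow>
    (f has_derivative (\<lambda>h. h$1 *\<^sub>R pd 1 f p + h$2 *\<^sub>R pd 2 f p)) (at p)"
  using smooth_on_differentiable has_derivative_pd by blast

lemma smooth_on_subset: "smooth_on S f \<Longrightarrow> S' \<subseteq> S \<Longrightarrow> smooth_on S' f"
  using Ck_on_subset unfolding smooth_on_def by blast

lemma smooth_on_cong:
  "open S \<Longrightarrow> (\<And>x. x \<in> S \<Longrightarrow> f x = g x) \<Longrightarrow> smooth_on S f \<longleftrightarrow> smooth_on S g"
  using Ck_on_cong unfolding smooth_on_def by blast

lemma smooth_on_const: "smooth_on S (\<lambda>_. c)"
  by (simp add: smooth_on_def Ck_on_const)

lemma smooth_on_add:
  "open S \<Longrightarrow> smooth_on S f \<Longrightarrow> smooth_on S g \<Longrightarrow> smooth_on S (\<lambda>x. f x + g x)"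
  by (simp add: smooth_on_def Ck_on_add)

lemma smooth_on_linear:
  "open S \<Longrightarrow> bounded_linear L \<Longrightarrow> smooth_on S f \<Longrightarrow> smooth_on S (\<lambda>x. L (f x))"
  by (simp add: smooth_on_def Ck_on_linear)

lemma smooth_on_minus:
  "open S \<Longrightarrow> smooth_on S f \<Longrightarrow> smooth_on S (\<lambda>x. - f x)"
  by (rule smooth_on_linear[OF _ bounded_linear_minus[OF bounded_linear_ident]])

lemma smooth_on_diff:
  "open S \<Longrightarrow> smooth_on S f \<Longrightarrow> smooth_on S g \<Longrightarrow> smooth_on S (\<lambda>x. f x - g x)"
  using smooth_on_add[of S f "\<lambda>x. - g x"] smooth_on_minus[of S g] by simp

lemma smooth_on_nth:
  "open S \<Longrightarrow> smooth_on S f \<Longrightarrow> smooth_on S (\<lambda>x. f x $ i)" for f :: "real^2 \<Rightarrow> real^'n"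
  by (rule smooth_on_linear[OF _ bounded_linear_vec_nth])

lemma smooth_on_scaleR:
  "open S \<Longrightarrow> smooth_on S f \<Longrightarrow> smooth_on S g \<Longrightarrow> smooth_on S (\<lambda>x. f x *\<^sub>R g x)"
  by (simp add: smooth_on_def Ck_on_bilinear[OF _ bounded_bilinear_scaleR])

lemma smooth_on_mult:
  "open S \<Longrightarrow> smooth_on S f \<Longrightarrow> smooth_on S g \<Longrightarrow> smooth_on S (\<lambda>x. f x * g x :: real)"
  by (simp add: smooth_on_def Ck_on_bilinear[OF _ bounded_bilinear_mult])

lemma smooth_on_compose:
  "open S \<Longrightarrow> \<phi> ` S \<subseteq> T \<Longrightarrow> smooth_on S \<phi> \<Longrightarrow> smooth_on T f \<Longrightarrow> smooth_on S (\<lambda>x. f (\<phi> x))"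
  unfolding smooth_on_def using Ck_on_compose by blast

lemma smooth_on_ident: "smooth_on S (\<lambda>x. x)"
proof -
  have "pd i (\<lambda>x. x) = (\<lambda>_. axis i 1)" for i by (simp add: pd_def fun_eq_iff)
  then show ?thesis by (subst smooth_on_iff) (simp add: smooth_on_const)
qed

lemma smooth_on_vec:
  fixes f :: "real^2 \<Rightarrow> real^'n"
  assumes "open S" "\<And>i. smooth_on S (\<lambda>x. f x $ i)"
  shows "smooth_on S f"
proof -
  have sm: "smooth_on S (\<lambda>x. \<Sum>i\<in>I. f x $ i *\<^sub>R axis i (1::real))" for I
    by (induction I rule: infinite_finite_induct)
      (simp_all add: smooth_on_const smooth_on_add smooth_on_scaleR assms)
  have eq: "(\<lambda>x. \<Sum>i\<in>UNIV. f x $ i *\<^sub>R axis i (1::real)) = f"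
    by (simp add: fun_eq_iff vec_eq_iff axis_def if_distrib[where f="\<lambda>t. _ * t"] cong: if_cong)
  show ?thesis using sm[of UNIV] unfolding eq .
qed

text \<open>The outer function changes to its derivative at each order, so the induction runs over a
  family \<open>F\<close> closed under differentiation: \<open>{exp}\<close> for the exponential,
  the multiples of powers of \<open>inverse\<close> for the reciprocal.\<close>

lemma Ck_on_real_compose:
  fixes g :: "real \<Rightarrow> real"
  assumes "open S" "f ` S \<subseteq> T" "smooth_on S f"
    and g: "g \<in> F" "\<And>g. g \<in> F \<Longrightarrow> continuous_on T g"
      "\<And>g. g \<in> F \<Longrightarrow> \<exists>g'\<in>F. \<forall>t\<in>T. (g has_real_derivative g' t) (at t)"
  shows "Ck_on k S (\<lambda>x. g (f x))"
  using g(1)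
proof (induction k arbitrary: g)
  case 0
  then show ?case using continuous_on_compose2[OF g(2) smooth_on_continuous[OF assms(3)] assms(2)] by simp
next
  case (Suc k)
  then obtain g' where g': "g' \<in> F" "\<And>t. t \<in> T \<Longrightarrow> (g has_real_derivative g' t) (at t)"
    using g(3) by metis
  have der: "((\<lambda>x. g (f x)) has_derivative (\<lambda>h. g' (f p) * frechet_derivative f (at p) h)) (at p)"
    if "p \<in> S" for p
    using has_derivative_compose[of f "frechet_derivative f (at p)" p UNIV g "(*) (g' (f p))"]
      g'(2)[of "f p"] that assms smooth_on_differentiable[OF assms(3) that]
    by (auto simp: has_field_derivative_def frechet_derivative_works)
  have "Ck_on k S (\<lambda>x. g' (f x) * pd i f x)" for i
    using Suc.IH[OF g'(1)] smooth_on_pd[OF assms(3), of i]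
    by (intro Ck_on_bilinear[OF assms(1) bounded_bilinear_mult]) (auto simp: smooth_on_def)
  then show ?case
    by (intro Ck_on_SucI[OF assms(1) der]) (simp_all add: pd_def[symmetric])
qed

lemma smooth_on_exp: "open S \<Longrightarrow> smooth_on S f \<Longrightarrow> smooth_on S (\<lambda>x. exp (f x :: real))"
  unfolding smooth_on_def[of S "\<lambda>x. exp (f x)"]
  by (intro allI Ck_on_real_compose[where T=UNIV and F="{exp}"]) (auto intro!: derivative_intros continuous_intros)

lemma smooth_on_inverse:
  assumes "open S" "smooth_on S f" "\<And>x. x \<in> S \<Longrightarrow> f x \<noteq> 0"
  shows "smooth_on S (\<lambda>x. inverse (f x :: real))"
proof -
  have "\<exists>g'\<in>{g. \<exists>c n. g = (\<lambda>t. c * inverse t ^ n)}. \<forall>t\<in>- {0}. (g has_real_derivative g' t) (at t)"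
    if "\<exists>c n. g = (\<lambda>t. c * inverse t ^ n)" for g :: "real \<Rightarrow> real"
  proof -
    from that obtain c n where g: "g = (\<lambda>t. c * inverse t ^ n)" by blast
    have "(g has_real_derivative (- c * n) * inverse t ^ Suc n) (at t)" if "t \<in> -{0}" for t
    proof -
      have "(g has_real_derivative c * (n * (- (inverse t ^ Suc (Suc 0)) * inverse t ^ (n - Suc 0)))) (at t)"
        unfolding g using that by (intro DERIV_cmult DERIV_power DERIV_inverse) simp
      \<comment> \<open>The truncated exponent \<open>n - Suc 0\<close> is wrong only for
        \<open>n = 0\<close>, where the factor \<open>n\<close> removes the term.\<close>
      then show ?thesis by (cases n) (simp_all add: algebra_simps)
    qed
    then show ?thesis by (intro bexI[of _ "\<lambda>t. (- c * n) * inverse t ^ Suc n"]) blast+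
  qed
  moreover have "inverse \<in> {g. \<exists>c n. g = (\<lambda>t::real. c * inverse t ^ n)}"
    by (auto intro!: exI[of _ 1] simp: fun_eq_iff)
  ultimately show ?thesis unfolding smooth_on_def using assms
    by (intro allI Ck_on_real_compose[where T="-{0}" and F="{g. \<exists>c n. g = (\<lambda>t. c * inverse t ^ n)}"])
      (auto intro!: continuous_intros)
qed

text \<open>One differentiation leads from \<open>ln\<close> to \<open>inverse\<close>, which is
  already known to be smooth, so no further induction on the order arises.\<close>

lemma smooth_on_ln:
  assumes "open S" "smooth_on S f" "\<And>x. x \<in> S \<Longrightarrow> f x > 0"
  shows "smooth_on S (\<lambda>x. ln (f x :: real))"
proof -
  have der: "((\<lambda>x. ln (f x)) has_derivative
      (\<lambda>h. frechet_derivative f (at p) h * inverse (f p))) (at p)" if "p \<in> S" for p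
    using smooth_on_differentiable[OF assms(2) that] assms(3)[OF that]
    unfolding frechet_derivative_works by (auto intro!: derivative_eq_intros simp: divide_inverse)
  have "smooth_on S (\<lambda>x. pd i f x * inverse (f x))" for i
    using assms by (intro smooth_on_mult smooth_on_inverse smooth_on_pd) force+
  then have "Ck_on (Suc k) S (\<lambda>x. ln (f x))" for k
    by (intro Ck_on_SucI[OF assms(1) der]) (simp_all add: pd_def[symmetric] smooth_on_def)
  then show ?thesis unfolding smooth_on_def using Ck_on_SucD by blast
qed

lemma pd_linear:
  assumes "bounded_linear L" "f differentiable (at p)"
  shows "pd i (\<lambda>x. L (f x)) p = L (pd i f p)"
  using pd_eqI[OF bounded_linear.has_derivative[OF assms(1) has_derivative_pd[OF assms(2)]], of i]
    pd_eqI[OF has_derivative_pd[OF assms(2)], of i] by simp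

lemma pd_nth:
  fixes f :: "real^2 \<Rightarrow> real^'n"
  shows "f differentiable (at p) \<Longrightarrow> pd i f p $ k = pd i (\<lambda>x. f x $ k) p"
  using pd_linear[OF bounded_linear_vec_nth] by metis

section \<open>Symmetry of second derivatives\<close>

lemma has_real_derivative_line:
  fixes F :: "real^2 \<Rightarrow> real"
  assumes "F differentiable (at (q + a *\<^sub>R axis i 1))"
  shows "((\<lambda>a. F (q + a *\<^sub>R axis i 1)) has_real_derivative pd i F (q + a *\<^sub>R axis i 1)) (at a)"
proof -
  let ?D = "frechet_derivative F (at (q + a *\<^sub>R axis i 1))"
  have "((\<lambda>a. F (q + a *\<^sub>R axis i 1)) has_derivative (\<lambda>h. ?D (h *\<^sub>R axis i 1))) (at a)"
    by (rule has_derivative_compose[of "\<lambda>a. q + a *\<^sub>R axis i 1"])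
      (use assms in \<open>auto simp: frechet_derivative_works intro!: derivative_eq_intros\<close>)
  moreover have "?D (h *\<^sub>R axis i 1) = pd i F (q + a *\<^sub>R axis i 1) * h" for h
    using linear_scale[OF linear_frechet_derivative[OF assms]] by (simp add: pd_def)
  ultimately show ?thesis by (simp add: has_field_derivative_def)
qed

text \<open>The second difference is symmetric in \<open>i\<close> and \<open>j\<close>, whence the symmetry of second derivatives.\<close>

lemma second_difference:
  fixes F :: "real^2 \<Rightarrow> real"
  assumes F: "smooth_on S F" and "t > 0"
    and S: "\<And>a b. 0 \<le> a \<Longrightarrow> a \<le> t \<Longrightarrow> 0 \<le> b \<Longrightarrow> b \<le> t \<Longrightarrow> p + a *\<^sub>R axis i 1 + b *\<^sub>R axis j 1 \<in> S"
  obtains a b where "0 < a" "a < t" "0 < b" "b < t"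
    "F (p + t *\<^sub>R axis i 1 + t *\<^sub>R axis j 1) - F (p + t *\<^sub>R axis i 1) - F (p + t *\<^sub>R axis j 1) + F p
      = t * t * pd j (pd i F) (p + a *\<^sub>R axis i 1 + b *\<^sub>R axis j 1)"
proof -
  \<comment> \<open>The mean value theorem is applied twice: along \<open>axis i 1\<close> to the
    increment of \<open>F\<close> in direction \<open>j\<close>, then along \<open>axis j 1\<close>
    to \<open>pd i F\<close>.\<close>
  let ?g = "\<lambda>a. F ((p + t *\<^sub>R axis j 1) + a *\<^sub>R axis i 1) - F (p + a *\<^sub>R axis i 1)"
  let ?g' = "\<lambda>a. pd i F ((p + t *\<^sub>R axis j 1) + a *\<^sub>R axis i 1) - pd i F (p + a *\<^sub>R axis i 1)"
  have "(?g has_real_derivative ?g' a) (at a)" if "0 \<le> a" "a \<le> t" for a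
    using S[of a t] S[of a 0] that \<open>t > 0\<close>
    by (intro DERIV_diff has_real_derivative_line smooth_on_differentiable[OF F]) (auto simp: algebra_simps)
  from MVT2[OF \<open>t > 0\<close> this] obtain a where a: "0 < a" "a < t" "?g t - ?g 0 = t * ?g' a" by auto
  have "((\<lambda>b. pd i F ((p + a *\<^sub>R axis i 1) + b *\<^sub>R axis j 1)) has_real_derivative
      pd j (pd i F) ((p + a *\<^sub>R axis i 1) + b *\<^sub>R axis j 1)) (at b)" if "0 \<le> b" "b \<le> t" for b
    using S[of a b] that a
    by (intro has_real_derivative_line smooth_on_differentiable[OF smooth_on_pd[OF F]]) auto
  from MVT2[OF \<open>t > 0\<close> this] obtain b where b: "0 < b" "b < t"
    "pd i F ((p + a *\<^sub>R axis i 1) + t *\<^sub>R axis j 1) - pd i F ((p + a *\<^sub>R axis i 1) + 0 *\<^sub>R axis j 1)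
      = t * pd j (pd i F) ((p + a *\<^sub>R axis i 1) + b *\<^sub>R axis j 1)" by auto
  show thesis
    by (rule that[OF a(1,2) b(1,2)]) (use a(3) b(3) in \<open>simp add: algebra_simps\<close>)
qed

text \<open>Over a small square the same second difference equals \<open>t * t\<close> times either
  mixed derivative, each at some point of the square. By continuity both values are within half the
  supposed distance \<open>d\<close> of those at \<open>p\<close>, a contradiction.\<close>

lemma pd_commute_real:
  fixes F :: "real^2 \<Rightarrow> real"
  assumes "open S" "p \<in> S" and F: "smooth_on S F"
  shows "pd i (pd j F) p = pd j (pd i F) p"
proof (rule ccontr)
  let ?A = "pd i (pd j F)" and ?B = "pd j (pd i F)"
  define d where "d = dist (?A p) (?B p)"
  assume "?A p \<noteq> ?B p"
  then have "d > 0" by (simp add: d_def)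
  have cont: "continuous (at p) (pd i (pd j F))" for i j
    using smooth_on_continuous[OF smooth_on_pd[OF smooth_on_pd[OF F]]] assms continuous_on_eq_continuous_at by blast
  obtain r1 where r1: "r1 > 0" "\<And>q. dist q p < r1 \<Longrightarrow> dist (?A q) (?A p) < d/2"
    using cont[unfolded continuous_at_eps_delta, rule_format, of "d/2"] \<open>d > 0\<close> by (metis half_gt_zero)
  obtain r2 where r2: "r2 > 0" "\<And>q. dist q p < r2 \<Longrightarrow> dist (?B q) (?B p) < d/2"
    using cont[unfolded continuous_at_eps_delta, rule_format, of "d/2"] \<open>d > 0\<close> by (metis half_gt_zero)
  obtain r3 where r3: "r3 > 0" "\<And>q. dist q p < r3 \<Longrightarrow> q \<in> S"
    using assms(1,2) by (metis open_dist)
  \<comment> \<open>A point of the square of side \<open>t\<close> at \<open>p\<close> is at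
    distance at most \<open>2 * t\<close> from \<open>p\<close>; dividing by 3 keeps this strictly
    below all three radii.\<close>
  define t where "t = min r1 (min r2 r3) / 3"
  have t: "t > 0" "2 * t < r1" "2 * t < r2" "2 * t < r3" using r1 r2 r3 by (auto simp: t_def)
  have near: "dist (p + a *\<^sub>R axis k 1 + b *\<^sub>R axis l 1) p \<le> 2 * t"
    if "0 \<le> a" "a \<le> t" "0 \<le> b" "b \<le> t" for a b and k l :: 2
  proof -
    have "norm (a *\<^sub>R axis k 1 + b *\<^sub>R axis l (1::real)) \<le> a + b"
      by (rule norm_triangle_le) (use that in simp)
    then show ?thesis using that by (simp add: dist_norm)
  qed
  have inS: "p + a *\<^sub>R axis k 1 + b *\<^sub>R axis l 1 \<in> S"
    if "0 \<le> a" "a \<le> t" "0 \<le> b" "b \<le> t" for a b and k l :: 2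
    by (rule r3(2)) (use near[OF that, of k l] t(4) in linarith)
  obtain a b where ab: "0 < a" "a < t" "0 < b" "b < t"
    "F (p + t *\<^sub>R axis i 1 + t *\<^sub>R axis j 1) - F (p + t *\<^sub>R axis i 1) - F (p + t *\<^sub>R axis j 1) + F p
      = t * t * ?B (p + a *\<^sub>R axis i 1 + b *\<^sub>R axis j 1)"
    by (rule second_difference[OF F t(1) inS[of _ _ i j]])
  obtain a' b' where ab': "0 < a'" "a' < t" "0 < b'" "b' < t"
    "F (p + t *\<^sub>R axis j 1 + t *\<^sub>R axis i 1) - F (p + t *\<^sub>R axis j 1) - F (p + t *\<^sub>R axis i 1) + F p
      = t * t * ?A (p + a' *\<^sub>R axis j 1 + b' *\<^sub>R axis i 1)"
    by (rule second_difference[OF F t(1) inS[of _ _ j i]])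
  have "t * t * ?B (p + a *\<^sub>R axis i 1 + b *\<^sub>R axis j 1) = t * t * ?A (p + a' *\<^sub>R axis j 1 + b' *\<^sub>R axis i 1)"
    using ab(5) ab'(5) by (simp add: algebra_simps)
  then have eq: "?B (p + a *\<^sub>R axis i 1 + b *\<^sub>R axis j 1) = ?A (p + a' *\<^sub>R axis j 1 + b' *\<^sub>R axis i 1)"
    using t(1) by simp
  have "dist (?B (p + a *\<^sub>R axis i 1 + b *\<^sub>R axis j 1)) (?B p) < d/2"
    by (rule r2(2)) (use near[of a b i j] ab t in linarith)
  moreover have "dist (?A (p + a' *\<^sub>R axis j 1 + b' *\<^sub>R axis i 1)) (?A p) < d/2"
    by (rule r1(2)) (use near[of a' b' j i] ab' t in linarith)
  ultimately show False unfolding eq d_def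
    by (metis dist_commute dist_triangle_half_r less_irrefl)
qed

lemma pd_commute:
  fixes f :: "real^2 \<Rightarrow> real^'n"
  assumes "open S" "p \<in> S" and f: "smooth_on S f"
  shows "pd i (pd j f) p = pd j (pd i f) p"
proof -
  have nth: "pd i (pd j f) p $ k = pd i (pd j (\<lambda>x. f x $ k)) p" for i j k
  proof -
    have "pd i (pd j f) p $ k = pd i (\<lambda>x. pd j f x $ k) p"
      using pd_nth smooth_on_differentiable[OF smooth_on_pd[OF f] assms(2)] by blast
    also have "\<dots> = pd i (pd j (\<lambda>x. f x $ k)) p"
      by (rule pd_cong_open[OF assms(1,2)]) (simp add: pd_nth smooth_on_differentiable[OF f])
    finally show ?thesis .
  qed
  show ?thesis
    using pd_commute_real[OF assms(1,2) smooth_on_nth[OF assms(1) f]] by (simp add: vec_eq_iff nth)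
qed

section \<open>Smooth local inverses\<close>

definition jac_det :: "(real^2 \<Rightarrow> real^2) \<Rightarrow> real^2 \<Rightarrow> real"
  where "jac_det \<phi> p = pd 1 \<phi> p $ 1 * pd 2 \<phi> p $ 2 - pd 2 \<phi> p $ 1 * pd 1 \<phi> p $ 2"

lemma smooth_on_jac_det: "open S \<Longrightarrow> smooth_on S \<phi> \<Longrightarrow> smooth_on S (jac_det \<phi>)"
  unfolding jac_det_def[abs_def]
  by (intro smooth_on_diff smooth_on_mult smooth_on_nth smooth_on_pd)

text \<open>Cramer's rule for the matrix with rows \<open>a, b\<close> and \<open>c, d\<close>: the
  first two equations say that the adjugate over \<open>J\<close> is a left inverse, the last two
  that it is a right inverse.\<close>

lemma inverse_2x2:
  fixes a b c d J :: real
  assumes "a * d - b * c = J" "J \<noteq> 0"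
  shows "inverse J * (d * (x * a + y * b) - b * (x * c + y * d)) = x"
    and "inverse J * (a * (x * c + y * d) - c * (x * a + y * b)) = y"
    and "inverse J * (d * x - b * y) * a + inverse J * (a * y - c * x) * b = x"
    and "inverse J * (d * x - b * y) * c + inverse J * (a * y - c * x) * d = y"
proof -
  have "d * (x * a + y * b) - b * (x * c + y * d) = J * x" "a * (x * c + y * d) - c * (x * a + y * b) = J * y"
    "inverse J * (d * x - b * y) * a + inverse J * (a * y - c * x) * b = inverse J * (J * x)"
    "inverse J * (d * x - b * y) * c + inverse J * (a * y - c * x) * d = inverse J * (J * y)"
    unfolding assms(1)[symmetric] by algebra+
  then show "inverse J * (d * (x * a + y * b) - b * (x * c + y * d)) = x"
    "inverse J * (a * (x * c + y * d) - c * (x * a + y * b)) = y"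
    "inverse J * (d * x - b * y) * a + inverse J * (a * y - c * x) * b = x"
    "inverse J * (d * x - b * y) * c + inverse J * (a * y - c * x) * d = y"
    using assms(2) by simp_all
qed

text \<open>The inverse function theorem yields a differentiable inverse \<open>g\<close> whose
  derivative at \<open>y\<close> is \<open>A (g y)\<close>. As \<open>A\<close> is smooth,
  \<open>g\<close> of class C^k makes its derivative of class C^k, hence \<open>g\<close> of class
  C^(k+1); continuity starts the induction.\<close>

lemma smooth_local_inverse:
  fixes \<phi> :: "real^2 \<Rightarrow> real^2"
  assumes "open M" and \<phi>: "smooth_on M \<phi>" and "p \<in> M" and "jac_det \<phi> p \<noteq> 0"
  obtains V where "p \<in> V" "V \<subseteq> M" "diffeo_betw \<phi> V (\<phi> ` V)" "\<And>q. q \<in> V \<Longrightarrow> jac_det \<phi> q \<noteq> 0"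
proof -
  define M' where "M' = {q\<in>M. jac_det \<phi> q \<noteq> 0}"
  have "open M'"
    using continuous_open_preimage[OF smooth_on_continuous[OF smooth_on_jac_det[OF assms(1) \<phi>]] assms(1), of "- {0}"]
    by (simp add: M'_def vimage_def Int_def open_Compl)
  have "M' \<subseteq> M" "p \<in> M'" using assms by (auto simp: M'_def)
  define F where "F x = Blinfun (\<lambda>h::real^2. h$1 *\<^sub>R pd 1 \<phi> x + h$2 *\<^sub>R pd 2 \<phi> x)" for x
  have bl: "bounded_linear (\<lambda>h::real^2. h$1 *\<^sub>R pd 1 \<phi> x + h$2 *\<^sub>R pd 2 \<phi> x)" for x
    by (intro bounded_linear_add bounded_linear_scaleR_const bounded_linear_vec_nth)
  have f: "blinfun_apply (F x) = (\<lambda>h. h$1 *\<^sub>R pd 1 \<phi> x + h$2 *\<^sub>R pd 2 \<phi> x)" for x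
    unfolding F_def by (rule bounded_linear_Blinfun_apply[OF bl])
  \<comment> \<open>The inverse derivative is written out with the adjugate so that its smooth
    dependence on the base point is visible.\<close>
  define A :: "real^2 \<Rightarrow> real^2 \<Rightarrow> real^2" where "A q h = inverse (jac_det \<phi> q) *\<^sub>R
    ((pd 2 \<phi> q $ 2 * h$1 - pd 2 \<phi> q $ 1 * h$2) *\<^sub>R axis 1 1
      + (pd 1 \<phi> q $ 1 * h$2 - pd 1 \<phi> q $ 2 * h$1) *\<^sub>R axis 2 1)" for q h
  have blA: "bounded_linear (A q)" for q
    unfolding A_def[abs_def] by (intro bounded_linear_intros bounded_linear_vec_nth)
  have Af: "A q (blinfun_apply (F q) h) = h" and fA: "blinfun_apply (F q) (A q h) = h"
    if "q \<in> M'" for q h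
  proof -
    have "jac_det \<phi> q \<noteq> 0" using that by (simp add: M'_def)
    then show "A q (blinfun_apply (F q) h) = h" "blinfun_apply (F q) (A q h) = h"
      using inverse_2x2[OF jac_det_def[symmetric, of \<phi> q]] unfolding f A_def
      by (simp_all add: vec_eq_iff forall_2 axis_def)
  qed
  have der: "(\<phi> has_derivative blinfun_apply (F x)) (at x)" if "x \<in> M'" for x
    unfolding f using smooth_on_has_derivative[OF \<phi>] that \<open>M' \<subseteq> M\<close> by blast
  have "continuous_on M' (pd i \<phi>)" for i
    using smooth_on_continuous[OF smooth_on_pd[OF \<phi>]] \<open>M' \<subseteq> M\<close> continuous_on_subset by blast
  then have contF: "continuous_on M' F"
    by (intro continuous_on_blinfun_componentwise) (auto simp: f intro!: continuous_intros)
  have invF: "Blinfun (A p) o\<^sub>L F p = id_blinfun"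
    by (rule blinfun_eqI) (simp add: bounded_linear_Blinfun_apply[OF blA] Af \<open>p \<in> M'\<close>)
  obtain V W g g' where V: "open V" "V \<subseteq> M'" "p \<in> V" "open W" "\<phi> p \<in> W" 
    and hom: "homeomorphism V W \<phi> g"
    and g: "\<And>y. y \<in> W \<Longrightarrow> (g has_derivative (g' y)) (at y)"
    and g': "\<And>y. y \<in> W \<Longrightarrow> g' y = inv (blinfun_apply (F (g y)))"
      "\<And>y. y \<in> W \<Longrightarrow> bij (blinfun_apply (F (g y)))"
    by (rule inverse_function_theorem[OF \<open>open M'\<close> der contF \<open>p \<in> M'\<close> invF]) (assumption, rule that)
  have gW: "g ` W = V" "\<And>y. y \<in> W \<Longrightarrow> \<phi> (g y) = y" "\<phi> ` V = W" "\<And>x. x \<in> V \<Longrightarrow> g (\<phi> x) = x"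
    using hom by (auto simp: homeomorphism_def)
  have bij: "bij_betw \<phi> V W" by (rule bij_betwI[of _ _ _ g]) (use gW in auto)
  have "inv_into V \<phi> y = g y" if "y \<in> W" for y
    using gW that by (intro inv_into_f_eq) (auto intro: inj_on_inverseI)
  then have inv: "smooth_on W (inv_into V \<phi>) \<longleftrightarrow> smooth_on W g"
    using smooth_on_cong[OF \<open>open W\<close>] by blast
  have g'A: "g' y h = A (g y) h" if "y \<in> W" for y h
  proof -
    have "g y \<in> M'" using gW(1) that V(2) by blast
    then show ?thesis unfolding g'(1)[OF that]
      by (intro inv_f_eq bij_is_inj g'(2)[OF that] fA)
  qed
  have smA: "smooth_on V (\<lambda>q. A q h)" for h
  proof -
    have "smooth_on V \<phi>" using smooth_on_subset[OF \<phi>] V(2) \<open>M' \<subseteq> M\<close> by blast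
    then show ?thesis using V unfolding A_def by (intro smooth_on_scaleR smooth_on_inverse smooth_on_jac_det smooth_on_add
          smooth_on_diff smooth_on_mult smooth_on_nth smooth_on_pd smooth_on_const) (auto simp: M'_def)
  qed
  have "Ck_on k W g" for k
  proof (induction k)
    case 0
    then show ?case using hom by (simp add: homeomorphism_def)
  next
    case (Suc k)
    have "Ck_on k W (\<lambda>y. A (g y) h)" for h
      using Ck_on_compose[OF \<open>open W\<close> _ Suc, of V "\<lambda>q. A q h"] smA[of h] gW(1) by (simp add: smooth_on_def)
    then have "Ck_on k W (\<lambda>y. g' y h)" for h
      using Ck_on_cong[OF \<open>open W\<close>, of "\<lambda>y. g' y h" "\<lambda>y. A (g y) h" k] g'A by blast
    then show ?case by (intro Ck_on_SucI[OF \<open>open W\<close> g])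
  qed
  then have "smooth_on W g" by (simp add: smooth_on_def)
  moreover have "smooth_on V \<phi>" by (rule smooth_on_subset[OF \<phi>]) (use V(2) \<open>M' \<subseteq> M\<close> in simp)
  ultimately have "diffeo_betw \<phi> V (\<phi> ` V)"
    by (simp add: diffeo_betw_def gW(3) inv V(1,4) bij)
  moreover have "jac_det \<phi> q \<noteq> 0" if "q \<in> V" for q
    using V(2) that by (auto simp: M'_def)
  ultimately show thesis
    using V(2,3) \<open>M' \<subseteq> M\<close> by (intro that[of V]) simp_all
qed

section \<open>Minkowski space and mean curvature\<close>

lemma forall_index4: "(\<forall>i::4. P i) \<longleftrightarrow> P 0 \<and> P 1 \<and> P 2 \<and> P 3"
proof -
  have "(4::4) = 0" by simp
  then show ?thesis using forall_4[of P] by metis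
qed

lemma vec4_nth [simp]:
  "vec4 a b c d $ 0 = a" "vec4 a b c d $ 1 = b" "vec4 a b c d $ 2 = c" "vec4 a b c d $ 3 = d"
  by (simp_all add: vec4_def)

lemma vec4_eq_iff: "(v::real^4) = w \<longleftrightarrow> v$0 = w$0 \<and> v$1 = w$1 \<and> v$2 = w$2 \<and> v$3 = w$3"
  by (simp add: vec_eq_iff forall_index4)

lemma mink_bilinear:
  "mink (v + w) u = mink v u + mink w u" "mink u (v + w) = mink u v + mink u w"
  "mink (v - w) u = mink v u - mink w u" "mink u (v - w) = mink u v - mink u w"
  "mink (c *\<^sub>R v) u = c * mink v u" "mink u (c *\<^sub>R v) = c * mink u v"
  "mink (- v) u = - mink v u" "mink u (- v) = - mink u v"
  "mink 0 u = 0" "mink u 0 = 0"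
  by (simp_all add: mink_def algebra_simps)

lemma mink_commute: "mink v w = mink w v"
  by (simp add: mink_def algebra_simps)

lemma mink_has_derivative:
  assumes "(f has_derivative f') (at p)" "(g has_derivative g') (at p)"
  shows "((\<lambda>x. mink (f x) (g x)) has_derivative (\<lambda>h. mink (f p) (g' h) + mink (f' h) (g p))) (at p)"
  unfolding mink_def
  by (rule derivative_eq_intros bounded_linear.has_derivative[OF bounded_linear_vec_nth] assms refl)+
    (simp add: fun_eq_iff algebra_simps)

lemma pd_mink:
  assumes "f differentiable (at p)" "g differentiable (at p)"
  shows "pd i (\<lambda>x. mink (f x) (g x)) p = mink (f p) (pd i g p) + mink (pd i f p) (g p)"
  using pd_eqI[OF mink_has_derivative[OF assms[unfolded frechet_derivative_works]]]
  by (simp add: pd_def)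

lemma H3_iff: "v \<in> H3 \<longleftrightarrow> mink v v = -1 \<and> v$0 > 0"
  by (auto simp: H3_def mink_def power2_eq_square)

text \<open>If \<open>v\<close> were not spacelike, the Cauchy-Schwarz inequality for the spatial
  parts (by Lagrange's identity) would give
  \<open>(v$0)\<^sup>2 * (1 + ?S) \<le> (v$0)\<^sup>2 * ?S\<close>. This forces
  \<open>v$0 = 0\<close> and then \<open>v = 0\<close>.\<close>

lemma H3_tangent_pos:
  assumes "s \<in> H3" "mink v s = 0" "v \<noteq> 0"
  shows "mink v v > 0"
proof (rule ccontr)
  let ?S = "(s$1)\<^sup>2 + (s$2)\<^sup>2 + (s$3)\<^sup>2" and ?V = "(v$1)\<^sup>2 + (v$2)\<^sup>2 + (v$3)\<^sup>2"
  let ?B = "v$1 * s$1 + v$2 * s$2 + v$3 * s$3"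
  assume "\<not> mink v v > 0"
  then have le: "?V \<le> (v$0)\<^sup>2" by (simp add: mink_def power2_eq_square)
  have s: "(s$0)\<^sup>2 = 1 + ?S" "s$0 > 0" and B: "v$0 * s$0 = ?B"
    using assms by (simp_all add: H3_def mink_def)
  have "?V * ?S - ?B\<^sup>2 = (v$1 * s$2 - v$2 * s$1)\<^sup>2 + (v$1 * s$3 - v$3 * s$1)\<^sup>2 + (v$2 * s$3 - v$3 * s$2)\<^sup>2"
    by algebra
  then have "?B\<^sup>2 \<le> ?V * ?S" by (smt (verit) zero_le_power2)
  moreover have "?B\<^sup>2 = (v$0)\<^sup>2 * (1 + ?S)" unfolding B[symmetric] by (simp add: power_mult_distrib s)
  moreover have "?V * ?S \<le> (v$0)\<^sup>2 * ?S" using le by (intro mult_right_mono) simp_all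
  ultimately have "(v$0)\<^sup>2 * (1 + ?S) \<le> (v$0)\<^sup>2 * ?S" by linarith
  then have "(v$0)\<^sup>2 \<le> 0" by (simp add: distrib_left)
  moreover from this le have "(v$1)\<^sup>2 \<le> 0" "(v$2)\<^sup>2 \<le> 0" "(v$3)\<^sup>2 \<le> 0"
    using zero_le_power2[of "v$1"] zero_le_power2[of "v$2"] zero_le_power2[of "v$3"] by linarith+
  ultimately show False using assms(3) by (simp add: vec4_eq_iff)
qed

section \<open>The mean curvature as a trace\<close>

lemma matrix_inv_eqI:
  fixes A B :: "real^'n^'n"
  assumes "A ** B = mat 1" "B ** A = mat 1"
  shows "matrix_inv A = B"
proof -
  have "A ** matrix_inv A = mat 1 \<and> matrix_inv A ** A = mat 1"
    unfolding matrix_inv_def by (rule someI[of _ B]) (simp add: assms)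
  then show ?thesis by (metis assms(2) matrix_mul_assoc matrix_mul_lid matrix_mul_rid)
qed

lemma trace_matrix_inv_mult_2:
  fixes A S :: "real^2^2"
  assumes "A$1$1 * A$2$2 - A$1$2 * A$2$1 \<noteq> 0"
  shows "trace (matrix_inv A ** S) =
    (A$2$2 * S$1$1 - A$1$2 * S$2$1 - A$2$1 * S$1$2 + A$1$1 * S$2$2) / (A$1$1 * A$2$2 - A$1$2 * A$2$1)"
proof -
  define d where "d = A$1$1 * A$2$2 - A$1$2 * A$2$1"
  define B :: "real^2^2" where "B = (\<chi> i j. (if i = 1 then if j = 1 then A$2$2 else - A$1$2
    else if j = 1 then - A$2$1 else A$1$1) / d)"
  have "d \<noteq> 0" using assms by (simp add: d_def)
  then have "A ** B = mat 1" "B ** A = mat 1"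
    by (simp_all add: vec_eq_iff forall_2 matrix_matrix_mult_def sum_2 mat_def B_def field_simps)
      (simp_all add: d_def algebra_simps)
  then have "matrix_inv A = B" by (rule matrix_inv_eqI)
  then show ?thesis unfolding d_def[symmetric]
    by (simp add: trace_def matrix_matrix_mult_def sum_2 B_def diff_divide_distrib add_divide_distrib)
qed

text \<open>The first form minus the second, that is, \<open>\<langle>d(s + N), ds\<rangle>\<close>.\<close>

definition mixed_form :: "(real^2 \<Rightarrow> real^4) \<Rightarrow> (real^2 \<Rightarrow> real^4) \<Rightarrow> 2 \<Rightarrow> 2 \<Rightarrow> real^2 \<Rightarrow> real"
  where "mixed_form s N i j p = mink (pd i s p + pd i N p) (pd j s p)"

text \<open>The second form is \<open>g\<close> minus the mixed form T, so the trace of g^-1 II is 2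
  minus the trace of g^-1 T. The latter must vanish, and multiplying it by the determinant of
  \<open>g\<close> leaves an equation without division.\<close>

lemma mean_curvature_eq_1_iff:
  fixes s N :: "real^2 \<Rightarrow> real^4"
  defines "g \<equiv> \<lambda>i j p. mink (pd i s p) (pd j s p)"
  assumes "g 1 1 p * g 2 2 p - (g 1 2 p)\<^sup>2 \<noteq> 0"
  shows "mean_curvature s N p = 1 \<longleftrightarrow>
    g 2 2 p * mixed_form s N 1 1 p - g 1 2 p * (mixed_form s N 1 2 p + mixed_form s N 2 1 p)
      + g 1 1 p * mixed_form s N 2 2 p = 0"
proof -
  have g: "g 2 1 p = g 1 2 p" by (simp add: g_def mink_commute)
  have I: "first_form s p $ i $ j = g i j p" for i j by (simp add: first_form_def g_def)
  have II: "second_form s N p $ i $ j = g i j p - mixed_form s N i j p" for i j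
    by (simp add: second_form_def mixed_form_def mink_bilinear g_def)
  define d where "d = g 1 1 p * g 2 2 p - g 1 2 p * g 1 2 p"
  have d: "d \<noteq> 0" using assms(2) by (simp add: d_def power2_eq_square)
  have "trace (matrix_inv (first_form s p) ** second_form s N p) =
    (g 2 2 p * (g 1 1 p - mixed_form s N 1 1 p)
    - g 1 2 p * (g 1 2 p - mixed_form s N 2 1 p) - g 1 2 p * (g 1 2 p - mixed_form s N 1 2 p)
    + g 1 1 p * (g 2 2 p - mixed_form s N 2 2 p)) / d"
    by (subst trace_matrix_inv_mult_2) (use d in \<open>simp_all add: I II g d_def\<close>)
  then have "mean_curvature s N p = 1 \<longleftrightarrow> g 2 2 p * (g 1 1 p - mixed_form s N 1 1 p)
    - g 1 2 p * (g 1 2 p - mixed_form s N 2 1 p) - g 1 2 p * (g 1 2 p - mixed_form s N 1 2 p)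
    + g 1 1 p * (g 2 2 p - mixed_form s N 2 2 p) = 2 * d"
    using d by (auto simp: mean_curvature_def nonzero_divide_eq_eq)
  then show ?thesis by (auto simp: d_def algebra_simps)
qed

section \<open>The Liouville map in a null frame\<close>

text \<open>The section of the light cone by the hyperplane where the pairing with
  \<open>null_inf\<close> is -1. It is a paraboloid whose induced metric is the flat metric of the
  plane; the sign of the first spatial entry follows the formulas of the theorem.\<close>

definition null_lift :: "real^2 \<Rightarrow> real^4"
  where "null_lift p = vec4 ((1 + (p$1)\<^sup>2 + (p$2)\<^sup>2) / 2) (- p$1) (p$2) ((1 - (p$1)\<^sup>2 - (p$2)\<^sup>2) / 2)"

definition null_lift_pd :: "2 \<Rightarrow> real^2 \<Rightarrow> real^4"
  where "null_lift_pd i p = (if i = 1 then vec4 (p$1) (-1) 0 (- p$1) else vec4 (p$2) 0 1 (- p$2))"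

definition null_inf :: "real^4"
  where "null_inf = vec4 1 0 0 (-1)"

lemma mink_frame:
  "mink (null_lift p) (null_lift p) = 0" "mink (null_lift p) (null_lift_pd i p) = 0" "mink (null_lift_pd i p) (null_lift p) = 0"
  "mink (null_lift p) null_inf = -1" "mink null_inf (null_lift p) = -1" "mink null_inf null_inf = 0"
  "mink (null_lift_pd i p) null_inf = 0" "mink null_inf (null_lift_pd i p) = 0"
  "mink (null_lift_pd i p) (null_lift_pd j p) = (if i = j then 1 else 0)"
  using exhaust_2[of i] exhaust_2[of j]
  by (auto simp: null_lift_def null_lift_pd_def null_inf_def mink_def field_simps power2_eq_square)

text \<open>Structure equations: \<open>null_lift\<close> is quadratic with second derivative the
  identity matrix times \<open>null_inf\<close>, so differentiation stays inside the frame.\<close>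

lemma has_derivative_frame:
  "(null_lift has_derivative (\<lambda>h. h$1 *\<^sub>R null_lift_pd 1 p + h$2 *\<^sub>R null_lift_pd 2 p)) (at p)"
  "(null_lift_pd i has_derivative (\<lambda>h. h$i *\<^sub>R null_inf)) (at p)"
proof -
  note nth = bounded_linear.has_derivative[OF bounded_linear_vec_nth has_derivative_ident]
  have "null_lift = (\<lambda>p. vec4 (1/2) 0 0 (1/2) + p$1 *\<^sub>R vec4 0 (-1) 0 0 + p$2 *\<^sub>R vec4 0 0 1 0
      + ((p$1)\<^sup>2 / 2 + (p$2)\<^sup>2 / 2) *\<^sub>R null_inf)"
    by (simp add: fun_eq_iff vec4_eq_iff null_lift_def null_inf_def field_simps)
  moreover have "(\<dots> has_derivative (\<lambda>h. h$1 *\<^sub>R null_lift_pd 1 p + h$2 *\<^sub>R null_lift_pd 2 p)) (at p)"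
    by (auto intro!: derivative_eq_intros nth
        simp: fun_eq_iff vec4_eq_iff null_lift_pd_def null_inf_def algebra_simps)
  ultimately show "(null_lift has_derivative (\<lambda>h. h$1 *\<^sub>R null_lift_pd 1 p + h$2 *\<^sub>R null_lift_pd 2 p)) (at p)"
    by simp
  have "null_lift_pd i = (\<lambda>p. (if i = 1 then vec4 0 (-1) 0 0 else vec4 0 0 1 0) + p$i *\<^sub>R null_inf)"
    using exhaust_2[of i] by (auto simp: fun_eq_iff vec4_eq_iff null_lift_pd_def null_inf_def)
  moreover have "(\<dots> has_derivative (\<lambda>h. h$i *\<^sub>R null_inf)) (at p)"
    by (rule derivative_eq_intros nth refl)+ simp
  ultimately show "(null_lift_pd i has_derivative (\<lambda>h. h$i *\<^sub>R null_inf)) (at p)"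
    by simp
qed

lemma smooth_on_null_lift:
  assumes "open S"
  shows "smooth_on S null_lift"
proof (rule smooth_on_vec[OF assms])
  have *: "smooth_on S (\<lambda>x. x $ i)" for i by (rule smooth_on_nth[OF assms smooth_on_ident])
  have "\<forall>i. smooth_on S (\<lambda>x. null_lift x $ i)"
    unfolding forall_index4 null_lift_def vec4_nth power2_eq_square divide_inverse
    by (intro conjI smooth_on_mult smooth_on_add smooth_on_diff smooth_on_minus smooth_on_const * assms)
  then show "smooth_on S (\<lambda>x. null_lift x $ i)" for i ..
qed

lemma has_derivative_frame_combination:
  assumes "(a has_derivative a') (at p)" "(b has_derivative b') (at p)"
    "(c has_derivative c') (at p)" "(e has_derivative e') (at p)"
  shows "((\<lambda>p. a p *\<^sub>R null_lift p + b p *\<^sub>R null_lift_pd 1 p + c p *\<^sub>R null_lift_pd 2 p + e p *\<^sub>R null_inf)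
    has_derivative (\<lambda>h. a' h *\<^sub>R null_lift p + (h$1 * a p + b' h) *\<^sub>R null_lift_pd 1 p
      + (h$2 * a p + c' h) *\<^sub>R null_lift_pd 2 p + (h$1 * b p + h$2 * c p + e' h) *\<^sub>R null_inf)) (at p)"
  by (rule derivative_eq_intros has_derivative_frame assms refl)+ (simp add: fun_eq_iff algebra_simps)

section \<open>The Liouville map and its derivative\<close>

definition grad2 :: "(real^2 \<Rightarrow> real) \<Rightarrow> real^2 \<Rightarrow> real"
  where "grad2 U p = (pd 1 U p)\<^sup>2 + (pd 2 U p)\<^sup>2"

text \<open>The partial derivative of exp(U/2) n divided by exp(U/2). Adding multiples of
  \<open>null_lift\<close> to the \<open>null_lift_pd\<close> keeps them orthonormal, because
  \<open>null_lift\<close> is null and orthogonal to them.\<close>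

definition liouville_frame :: "(real^2 \<Rightarrow> real) \<Rightarrow> 2 \<Rightarrow> real^2 \<Rightarrow> real^4"
  where "liouville_frame U i p = null_lift_pd i p + (pd i U p / 2) *\<^sub>R null_lift p"

text \<open>Up to the factor \<open>exp (- U p / 2) / 2\<close>, the matrix of the derivative of
  \<open>liouville_map U\<close> in \<open>liouville_frame\<close>. The gradient terms cancel in the
  trace, leaving the Liouville operator; the trace-free part is, up to constants, the real and
  imaginary part of U_zz - U_z^2 / 2.\<close>

definition liouville_hess :: "(real^2 \<Rightarrow> real) \<Rightarrow> 2 \<Rightarrow> 2 \<Rightarrow> real^2 \<Rightarrow> real"
  where "liouville_hess U i j p = pd i (pd j U) p - pd i U p * pd j U p / 2
    + (if i = j then exp (U p) + grad2 U p / 4 else 0)"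

lemma liouville_map_frame:
  "liouville_map U p =
    (exp (- U p / 2) * (grad2 U p / 8) + exp (U p / 2) / 2) *\<^sub>R null_lift p
    + (exp (- U p / 2) * (pd 1 U p / 2)) *\<^sub>R null_lift_pd 1 p
    + (exp (- U p / 2) * (pd 2 U p / 2)) *\<^sub>R null_lift_pd 2 p + exp (- U p / 2) *\<^sub>R null_inf"
  by (simp add: vec4_eq_iff liouville_map_def Let_def grad2_def null_lift_def null_lift_pd_def null_inf_def field_simps)

lemma mink_liouville_frame:
  "mink (liouville_frame U i p) (liouville_frame U j p) = (if i = j then 1 else 0)"
  "mink (null_lift p) (liouville_frame U i p) = 0" "mink (liouville_frame U i p) (null_lift p) = 0"
  by (simp_all add: liouville_frame_def mink_bilinear mink_frame)

text \<open>The envelope conditions, by which \<open>liouville_map_unique\<close> recognises the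
  map. In the norm the gradient terms cancel and only the product of the two exponentials
  remains.\<close>

lemma mink_liouville_map:
  "mink (liouville_map U p) (liouville_map U p) = -1"
  "mink (liouville_map U p) (null_lift p) = - exp (- U p / 2)"
  "mink (liouville_map U p) (liouville_frame U i p) = 0"
proof -
  have E: "exp (- U p / 2) * exp (U p / 2) = 1" by (simp add: exp_add[symmetric])
  show "mink (liouville_map U p) (null_lift p) = - exp (- U p / 2)"
    "mink (liouville_map U p) (liouville_frame U i p) = 0"
    using exhaust_2[of i]
    by (auto simp: liouville_map_frame liouville_frame_def mink_bilinear mink_frame)
  have "mink (liouville_map U p) (liouville_map U p) = - (exp (- U p / 2) * exp (U p / 2))"
    unfolding liouville_map_frame mink_bilinear mink_frame grad2_def by (simp add: field_simps power2_eq_square)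
  with E show "mink (liouville_map U p) (liouville_map U p) = -1" by simp
qed

lemma liouville_map_H3: "liouville_map U p \<in> H3"
proof -
  let ?x = "p$1" and ?y = "p$2" and ?a = "pd 1 U p" and ?b = "pd 2 U p"
  \<comment> \<open>Lagrange's identity for \<open>(?x, ?y)\<close> and \<open>(?a, ?b)\<close>,
    followed by completing the square with the constant 16.\<close>
  have "(1 + ?x\<^sup>2 + ?y\<^sup>2) * (?a\<^sup>2 + ?b\<^sup>2) + 8 * (?x * ?a + ?y * ?b) + 16
    = ?a\<^sup>2 + ?b\<^sup>2 + (?x * ?a + ?y * ?b + 4)\<^sup>2 + (?x * ?b - ?y * ?a)\<^sup>2"
    by algebra
  then have "(1 + ?x\<^sup>2 + ?y\<^sup>2) * (?a\<^sup>2 + ?b\<^sup>2) + 8 * (?x * ?a + ?y * ?b) + 16 \<ge> 0"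
    by simp
  moreover have "1 + ?x\<^sup>2 + ?y\<^sup>2 > 0" by (smt (verit) zero_le_power2)
  ultimately have "liouville_map U p $ 0 > 0"
    by (auto simp: liouville_map_def Let_def intro!: add_nonneg_pos)
  then show ?thesis by (simp add: H3_iff mink_liouville_map)
qed

text \<open>The coefficients of \<open>null_inf\<close> cancel, and those of \<open>null_lift\<close> are absorbed by the
  frame vectors.\<close>

lemma has_derivative_liouville_map:
  assumes "open D" "smooth_on D U" "p \<in> D"
  shows "(liouville_map U has_derivative (\<lambda>h. h$1 *\<^sub>R (exp (- U p / 2) / 2) *\<^sub>R
      (liouville_hess U 1 1 p *\<^sub>R liouville_frame U 1 p + liouville_hess U 1 2 p *\<^sub>R liouville_frame U 2 p)
    + h$2 *\<^sub>R (exp (- U p / 2) / 2) *\<^sub>R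
      (liouville_hess U 2 1 p *\<^sub>R liouville_frame U 1 p + liouville_hess U 2 2 p *\<^sub>R liouville_frame U 2 p))) (at p)"
    (is "(_ has_derivative ?D) _")
proof -
  note dU = smooth_on_has_derivative[OF assms(2,3)]
  note dUi = smooth_on_has_derivative[OF smooth_on_pd[OF assms(2)] assms(3)]
  define E W where "E = exp (- U p / 2)" and "W = exp (U p / 2)"
  \<comment> \<open>Identifies the term \<open>W / 2\<close> with the \<open>exp (U p)\<close> on
    the diagonal of \<open>liouville_hess\<close>, times \<open>E / 2\<close>.\<close>
  have W: "exp (U p) * E = W" by (simp add: E_def W_def exp_add[symmetric])
  have comm: "pd 2 (pd 1 U) p = pd 1 (pd 2 U) p" by (rule pd_commute_real[OF assms(1,3,2)])
  define u1 u2 u11 u12 u22 where u: "u1 = pd 1 U p" "u2 = pd 2 U p" "u11 = pd 1 (pd 1 U) p"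
    "u12 = pd 1 (pd 2 U) p" "u22 = pd 2 (pd 2 U) p"
  have dE: "((\<lambda>p. exp (- U p / 2)) has_derivative (\<lambda>h. E * (- (h$1 * u1 + h$2 * u2) / 2))) (at p)"
    unfolding E_def u by (auto intro!: derivative_eq_intros dU simp: fun_eq_iff field_simps)
  have dW: "((\<lambda>p. exp (U p / 2)) has_derivative (\<lambda>h. W * ((h$1 * u1 + h$2 * u2) / 2))) (at p)"
    unfolding W_def u by (auto intro!: derivative_eq_intros dU simp: fun_eq_iff)
  have dQ: "((\<lambda>p. grad2 U p / 8) has_derivative
    (\<lambda>h. (u1 * (h$1 * u11 + h$2 * u12) + u2 * (h$1 * u12 + h$2 * u22)) / 4)) (at p)"
    unfolding grad2_def
    by (auto intro!: derivative_eq_intros dUi simp: fun_eq_iff field_simps comm u[symmetric])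
  have da: "((\<lambda>p. exp (- U p / 2) * (grad2 U p / 8) + exp (U p / 2) / 2) has_derivative
    (\<lambda>h. E * (- (h$1 * u1 + h$2 * u2) / 2) * ((u1\<^sup>2 + u2\<^sup>2) / 8)
       + E * (u1 * (h$1 * u11 + h$2 * u12) + u2 * (h$1 * u12 + h$2 * u22)) / 4
       + W * ((h$1 * u1 + h$2 * u2) / 2) / 2)) (at p)"
    by (rule has_derivative_eq_rhs[OF has_derivative_add[OF has_derivative_mult[OF dE dQ]
            bounded_linear.has_derivative[OF bounded_linear_divide dW]]])
      (unfold E_def[symmetric] grad2_def u[symmetric], simp add: fun_eq_iff field_simps)
  have db: "((\<lambda>p. exp (- U p / 2) * (pd j U p / 2)) has_derivative
    (\<lambda>h. E * (- (h$1 * u1 + h$2 * u2) / 2) * (pd j U p / 2) + E * (h$1 * pd 1 (pd j U) p + h$2 * pd 2 (pd j U) p) / 2)) (at p)"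
    for j
    by (rule has_derivative_eq_rhs[OF has_derivative_mult[OF dE
            bounded_linear.has_derivative[OF bounded_linear_divide dUi]]])
      (unfold E_def[symmetric] u[symmetric], simp add: fun_eq_iff field_simps)
  let ?a' = "\<lambda>h. E * (- (h$1 * u1 + h$2 * u2) / 2) * ((u1\<^sup>2 + u2\<^sup>2) / 8)
       + E * (u1 * (h$1 * u11 + h$2 * u12) + u2 * (h$1 * u12 + h$2 * u22)) / 4
       + W * ((h$1 * u1 + h$2 * u2) / 2) / 2"
  let ?H = "liouville_hess U"
  have H: "?H 1 1 p = u11 - u1 * u1 / 2 + exp (U p) + (u1\<^sup>2 + u2\<^sup>2) / 4" "?H 1 2 p = u12 - u1 * u2 / 2"
    "?H 2 1 p = u12 - u1 * u2 / 2" "?H 2 2 p = u22 - u2 * u2 / 2 + exp (U p) + (u1\<^sup>2 + u2\<^sup>2) / 4"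
    by (simp_all add: liouville_hess_def grad2_def comm u)
  have "(liouville_map U has_derivative (\<lambda>h. ?a' h *\<^sub>R null_lift p
    + (h$1 * (E * ((u1\<^sup>2 + u2\<^sup>2) / 8) + W / 2)
       + (E * (- (h$1 * u1 + h$2 * u2) / 2) * (u1 / 2) + E * (h$1 * u11 + h$2 * u12) / 2)) *\<^sub>R null_lift_pd 1 p
    + (h$2 * (E * ((u1\<^sup>2 + u2\<^sup>2) / 8) + W / 2)
       + (E * (- (h$1 * u1 + h$2 * u2) / 2) * (u2 / 2) + E * (h$1 * u12 + h$2 * u22) / 2)) *\<^sub>R null_lift_pd 2 p
    + (h$1 * (E * (u1 / 2)) + h$2 * (E * (u2 / 2)) + E * (- (h$1 * u1 + h$2 * u2) / 2)) *\<^sub>R null_inf)) (at p)"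
    unfolding liouville_map_frame[abs_def]
    by (rule has_derivative_eq_rhs[OF has_derivative_frame_combination[OF da db db dE]])
      (unfold E_def[symmetric] W_def[symmetric] grad2_def comm u[symmetric], simp add: fun_eq_iff)
  then show ?thesis
  proof (rule has_derivative_eq_rhs, intro ext)
    fix h :: "real^2"
    have c: "?a' h = h$1 * (E / 2 * (?H 1 1 p * (u1 / 2) + ?H 1 2 p * (u2 / 2)))
        + h$2 * (E / 2 * (?H 2 1 p * (u1 / 2) + ?H 2 2 p * (u2 / 2)))"
      "h$1 * (E * ((u1\<^sup>2 + u2\<^sup>2) / 8) + W / 2)
       + (E * (- (h$1 * u1 + h$2 * u2) / 2) * (u1 / 2) + E * (h$1 * u11 + h$2 * u12) / 2)
       = h$1 * (E / 2 * ?H 1 1 p) + h$2 * (E / 2 * ?H 2 1 p)"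
      "h$2 * (E * ((u1\<^sup>2 + u2\<^sup>2) / 8) + W / 2)
       + (E * (- (h$1 * u1 + h$2 * u2) / 2) * (u2 / 2) + E * (h$1 * u12 + h$2 * u22) / 2)
       = h$1 * (E / 2 * ?H 1 2 p) + h$2 * (E / 2 * ?H 2 2 p)"
      "h$1 * (E * (u1 / 2)) + h$2 * (E * (u2 / 2)) + E * (- (h$1 * u1 + h$2 * u2) / 2) = 0"
      unfolding H W[symmetric] by (simp_all add: field_simps power2_eq_square)
    show "?a' h *\<^sub>R null_lift p
    + (h$1 * (E * ((u1\<^sup>2 + u2\<^sup>2) / 8) + W / 2)
       + (E * (- (h$1 * u1 + h$2 * u2) / 2) * (u1 / 2) + E * (h$1 * u11 + h$2 * u12) / 2)) *\<^sub>R null_lift_pd 1 p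
    + (h$2 * (E * ((u1\<^sup>2 + u2\<^sup>2) / 8) + W / 2)
       + (E * (- (h$1 * u1 + h$2 * u2) / 2) * (u2 / 2) + E * (h$1 * u12 + h$2 * u22) / 2)) *\<^sub>R null_lift_pd 2 p
    + (h$1 * (E * (u1 / 2)) + h$2 * (E * (u2 / 2)) + E * (- (h$1 * u1 + h$2 * u2) / 2)) *\<^sub>R null_inf = ?D h"
      unfolding c E_def[symmetric] liouville_frame_def u[symmetric]
      by (simp add: algebra_simps)
  qed
qed

lemma pd_liouville_map:
  assumes "open D" "smooth_on D U" "p \<in> D"
  shows "pd i (liouville_map U) p = (exp (- U p / 2) / 2) *\<^sub>R
    (liouville_hess U i 1 p *\<^sub>R liouville_frame U 1 p + liouville_hess U i 2 p *\<^sub>R liouville_frame U 2 p)"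
  unfolding pd_eqI[OF has_derivative_liouville_map[OF assms]]
  using exhaust_2[of i] by (auto simp: axis_def)

lemma liouville_hess_commute:
  assumes "open D" "smooth_on D U" "p \<in> D"
  shows "liouville_hess U i j p = liouville_hess U j i p"
  using pd_commute_real[OF assms(1,3,2), of i j] by (simp add: liouville_hess_def)

lemma liouville_hess_trace:
  "liouville_hess U 1 1 p + liouville_hess U 2 2 p = pd 1 (pd 1 U) p + pd 2 (pd 2 U) p + 2 * exp (U p)"
  by (simp add: liouville_hess_def grad2_def power2_eq_square field_simps)

text \<open>For a solution the matrix is trace-free, so its first diagonal entry is half the
  difference of the diagonal entries, where the exponential and \<open>grad2\<close> cancel.\<close>

lemma degenerate_at_iff:
  assumes "liouville_solution D U" "p \<in> D"
  shows "degenerate_at U p \<longleftrightarrow> liouville_hess U 1 1 p = 0 \<and> liouville_hess U 1 2 p = 0"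
proof -
  have "pd 1 (pd 1 U) p + pd 2 (pd 2 U) p + 2 * exp (U p) = 0"
    using assms by (simp add: liouville_solution_def)
  then show ?thesis
    by (auto simp: degenerate_at_def liouville_hess_def grad2_def power2_eq_square field_simps)
qed

lemma pd_exp_half_null_lift:
  assumes "U differentiable (at p)"
  shows "((\<lambda>p. exp (U p / 2) *\<^sub>R null_lift p) has_derivative (\<lambda>h. exp (U p / 2) *\<^sub>R
      (h$1 *\<^sub>R liouville_frame U 1 p + h$2 *\<^sub>R liouville_frame U 2 p))) (at p)"
    and "pd i (\<lambda>p. exp (U p / 2) *\<^sub>R null_lift p) p = exp (U p / 2) *\<^sub>R liouville_frame U i p"
proof -
  note dU = has_derivative_pd[OF assms]
  have dW: "((\<lambda>p. exp (U p / 2)) has_derivative (\<lambda>h. exp (U p / 2) * ((h$1 * pd 1 U p + h$2 * pd 2 U p) / 2))) (at p)"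
    by (auto intro!: derivative_eq_intros dU simp: fun_eq_iff)
  show *: "((\<lambda>p. exp (U p / 2) *\<^sub>R null_lift p) has_derivative (\<lambda>h. exp (U p / 2) *\<^sub>R
      (h$1 *\<^sub>R liouville_frame U 1 p + h$2 *\<^sub>R liouville_frame U 2 p))) (at p)"
    by (rule has_derivative_eq_rhs[OF has_derivative_scaleR[OF dW has_derivative_frame(1)]])
      (simp add: fun_eq_iff liouville_frame_def algebra_simps add_divide_distrib)
  show "pd i (\<lambda>p. exp (U p / 2) *\<^sub>R null_lift p) p = exp (U p / 2) *\<^sub>R liouville_frame U i p"
    using exhaust_2[of i] pd_eqI[OF *] by (auto simp: axis_def)
qed

lemma smooth_on_null_lift_pd:
  assumes "open S"
  shows "smooth_on S (null_lift_pd i)"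
proof -
  have "pd i null_lift = null_lift_pd i"
    using exhaust_2[of i] pd_eqI[OF has_derivative_frame(1)] by (auto simp: fun_eq_iff axis_def)
  then show ?thesis using smooth_on_pd[OF smooth_on_null_lift[OF assms], of i] by simp
qed

lemma smooth_on_grad2: "open D \<Longrightarrow> smooth_on D U \<Longrightarrow> smooth_on D (grad2 U)"
  unfolding grad2_def[abs_def] power2_eq_square
  by (intro smooth_on_add smooth_on_mult smooth_on_pd)

lemma smooth_on_divide_const:
  "open D \<Longrightarrow> smooth_on D f \<Longrightarrow> smooth_on D (\<lambda>p. f p / c)" for c :: real
  by (rule smooth_on_linear[OF _ bounded_linear_divide])

lemma smooth_on_liouville_map:
  assumes "open D" "smooth_on D U"
  shows "smooth_on D (liouville_map U)"
  unfolding liouville_map_frame[abs_def]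
  by (intro smooth_on_add smooth_on_scaleR smooth_on_mult smooth_on_exp smooth_on_divide_const smooth_on_minus
      smooth_on_const smooth_on_pd smooth_on_grad2 smooth_on_null_lift smooth_on_null_lift_pd assms)

lemma smooth_on_liouville_hess:
  assumes "open D" "smooth_on D U"
  shows "smooth_on D (liouville_hess U i j)"
proof -
  have "smooth_on D (\<lambda>p. if i = j then exp (U p) + grad2 U p / 4 else 0)"
    by (cases "i = j") (simp_all add: smooth_on_const smooth_on_add smooth_on_exp smooth_on_divide_const smooth_on_grad2 assms)
  then show ?thesis unfolding liouville_hess_def[abs_def]
    by (intro smooth_on_add smooth_on_diff smooth_on_mult smooth_on_divide_const smooth_on_pd assms)
qed

section \<open>Immersivity and mean curvature of the Liouville map\<close>

lemma inj_frechet_derivative_iff: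
  assumes "s differentiable (at p)"
  shows "inj (frechet_derivative s (at p)) \<longleftrightarrow>
    (\<forall>a b. a *\<^sub>R pd 1 s p + b *\<^sub>R pd 2 s p = 0 \<longrightarrow> a = 0 \<and> b = 0)"
proof -
  have D: "frechet_derivative s (at p) = (\<lambda>h. h$1 *\<^sub>R pd 1 s p + h$2 *\<^sub>R pd 2 s p)"
    using frechet_derivative_at[OF has_derivative_pd[OF assms]] by simp
  have "inj (frechet_derivative s (at p)) \<longleftrightarrow> (\<forall>h. frechet_derivative s (at p) h = 0 \<longrightarrow> h = 0)"
    using linear_injective_0[OF linear_frechet_derivative[OF assms]] .
  also have "\<dots> \<longleftrightarrow> (\<forall>a b. a *\<^sub>R pd 1 s p + b *\<^sub>R pd 2 s p = 0 \<longrightarrow> a = 0 \<and> b = 0)"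
  proof (intro iffI allI impI)
    fix a b assume h: "\<forall>h. frechet_derivative s (at p) h = 0 \<longrightarrow> h = 0"
      and "a *\<^sub>R pd 1 s p + b *\<^sub>R pd 2 s p = 0"
    then have "(\<chi> i. if i = 1 then a else b) = (0::real^2)" by (simp add: D)
    then show "a = 0 \<and> b = 0" by (simp add: vec_eq_iff forall_2)
  next
    fix h :: "real^2"
    assume "\<forall>a b. a *\<^sub>R pd 1 s p + b *\<^sub>R pd 2 s p = 0 \<longrightarrow> a = 0 \<and> b = 0" "frechet_derivative s (at p) h = 0"
    then show "h = 0" by (simp add: D vec_eq_iff forall_2)
  qed
  finally show ?thesis .
qed

text \<open>With H the symmetric matrix of \<open>a\<close>, \<open>b\<close>, \<open>c\<close>, the
  first form is \<open>E\<^sup>2 / 4\<close> times J^T H^2 J and the mixed form is half of J^T H J.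
  The trace condition then becomes
  \<open>k * h * d\<^sup>2 * (a * c - b\<^sup>2) * (a + c) = 0\<close>, and nondegeneracy of the
  first form makes every factor except the last nonzero. \<open>J\<close> is the Jacobian from the
  parameters of \<open>s\<close> to the Gauss coordinates.\<close>

lemma mean_curvature_frame:
  fixes e1 e2 :: "real^4" and J :: "2 \<Rightarrow> 2 \<Rightarrow> real"
  assumes e: "mink e1 e1 = 1" "mink e1 e2 = 0" "mink e2 e2 = 1" and "E \<noteq> 0" "W * E = 1"
    and s: "\<And>i. pd i s p = (E / 2) *\<^sub>R ((J 1 i * a + J 2 i * b) *\<^sub>R e1 + (J 1 i * b + J 2 i * c) *\<^sub>R e2)"
    and N: "\<And>i. pd i s p + pd i N p = W *\<^sub>R (J 1 i *\<^sub>R e1 + J 2 i *\<^sub>R e2)"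
    and g: "mink (pd 1 s p) (pd 1 s p) * mink (pd 2 s p) (pd 2 s p) - (mink (pd 1 s p) (pd 2 s p))\<^sup>2 \<noteq> 0"
  shows "mean_curvature s N p = 1 \<longleftrightarrow> a + c = 0"
proof -
  define d where "d = J 1 1 * J 2 2 - J 1 2 * J 2 1"
  \<comment> \<open>Naming the fractions makes the identities below polynomial.\<close>
  define k h where "k = E\<^sup>2 / 4" and "h = (1/2 :: real)"
  have kh: "k \<noteq> 0" "h \<noteq> 0" using \<open>E \<noteq> 0\<close> by (simp_all add: k_def h_def)
  have e': "mink e2 e1 = 0" using e(2) mink_commute by metis
  have gij: "mink (pd i s p) (pd j s p) = k *
      ((J 1 i * a + J 2 i * b) * (J 1 j * a + J 2 j * b) + (J 1 i * b + J 2 i * c) * (J 1 j * b + J 2 j * c))" for i j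
    unfolding s mink_bilinear e e' k_def by (simp add: power2_eq_square field_simps)
  have T: "mixed_form s N i j p =
      h * (J 1 i * (J 1 j * a + J 2 j * b) + J 2 i * (J 1 j * b + J 2 j * c))" for i j
  proof -
    have "mixed_form s N i j p = (W * E) *
      (J 1 i * (J 1 j * a + J 2 j * b) + J 2 i * (J 1 j * b + J 2 j * c)) / 2"
      unfolding mixed_form_def N unfolding s mink_bilinear e e' by (simp add: field_simps)
    then show ?thesis using assms(5) by (simp add: h_def)
  qed
  have "mink (pd 1 s p) (pd 1 s p) * mink (pd 2 s p) (pd 2 s p) - (mink (pd 1 s p) (pd 2 s p))\<^sup>2
    = k\<^sup>2 * (d * (a * c - b\<^sup>2))\<^sup>2"
    unfolding gij d_def by algebra
  with g have nz: "d \<noteq> 0" "a * c - b\<^sup>2 \<noteq> 0" by auto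
  have "mean_curvature s N p = 1 \<longleftrightarrow> k * h * d\<^sup>2 * (a * c - b\<^sup>2) * (a + c) = 0"
    unfolding mean_curvature_eq_1_iff[OF g] gij T d_def
    by (rule arg_cong[where f="\<lambda>x. x = 0"]) algebra
  with nz kh show ?thesis by simp
qed

definition liouville_normal :: "(real^2 \<Rightarrow> real) \<Rightarrow> real^2 \<Rightarrow> real^4"
  where "liouville_normal U p = exp (U p / 2) *\<^sub>R null_lift p - liouville_map U p"

lemma pd_add:
  assumes "f differentiable (at p)" "g differentiable (at p)"
  shows "pd i (\<lambda>x. f x + g x) p = pd i f p + pd i g p"
  using pd_eqI[OF has_derivative_add[OF assms[unfolded frechet_derivative_works]]] by (simp add: pd_def)

text \<open>In the independent frame vectors the derivative is a nonzero multiple of the symmetric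
  trace-free matrix with entries \<open>a\<close>, \<open>b\<close>, whose determinant is -(a^2 +
  b^2).\<close>

lemma immersive_liouville_map_iff:
  assumes U: "liouville_solution D U" and p: "p \<in> D"
  shows "immersive_at (liouville_map U) p \<longleftrightarrow> \<not> degenerate_at U p"
proof -
  have D: "open D" "smooth_on D U" using U by (auto simp: liouville_solution_def)
  define a b where "a = liouville_hess U 1 1 p" and "b = liouville_hess U 1 2 p"
  have tr: "liouville_hess U 2 2 p = - a"
    using liouville_hess_trace[of U p] U p by (simp add: liouville_solution_def a_def)
  have b: "liouville_hess U 2 1 p = b" using liouville_hess_commute[OF D p] by (simp add: b_def)
  define k where "k = exp (- U p / 2) / 2"
  have "k \<noteq> 0" by (simp add: k_def)
  let ?e = "\<lambda>i. liouville_frame U i p"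
  have comb: "x *\<^sub>R pd 1 (liouville_map U) p + y *\<^sub>R pd 2 (liouville_map U) p
      = (k * (x * a + y * b)) *\<^sub>R ?e 1 + (k * (x * b - y * a)) *\<^sub>R ?e 2" for x y
    unfolding pd_liouville_map[OF D p] tr b a_def[symmetric] b_def[symmetric] k_def[symmetric]
    by (simp add: algebra_simps)
  have indep: "c *\<^sub>R ?e 1 + d *\<^sub>R ?e 2 = 0 \<longleftrightarrow> c = 0 \<and> d = 0" for c d
  proof
    assume 0: "c *\<^sub>R ?e 1 + d *\<^sub>R ?e 2 = 0"
    show "c = 0 \<and> d = 0"
      using arg_cong[OF 0, of "mink (?e 1)"] arg_cong[OF 0, of "mink (?e 2)"]
      by (simp add: mink_bilinear mink_liouville_frame)
  qed simp
  have "immersive_at (liouville_map U) p \<longleftrightarrow>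
    (\<forall>x y. x * a + y * b = 0 \<and> x * b - y * a = 0 \<longrightarrow> x = 0 \<and> y = 0)"
    unfolding immersive_at_def
    using smooth_on_differentiable[OF smooth_on_liouville_map[OF D] p]
      inj_frechet_derivative_iff[OF smooth_on_differentiable[OF smooth_on_liouville_map[OF D] p]] comb indep \<open>k \<noteq> 0\<close>
    by simp
  also have "\<dots> \<longleftrightarrow> \<not> (a = 0 \<and> b = 0)"
  proof
    assume "\<forall>x y. x * a + y * b = 0 \<and> x * b - y * a = 0 \<longrightarrow> x = 0 \<and> y = 0"
    from this[rule_format, of 1 0] show "\<not> (a = 0 \<and> b = 0)" by auto
  next
    assume ab: "\<not> (a = 0 \<and> b = 0)"
    show "\<forall>x y. x * a + y * b = 0 \<and> x * b - y * a = 0 \<longrightarrow> x = 0 \<and> y = 0"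
    proof (intro allI impI)
      fix x y assume xy: "x * a + y * b = 0 \<and> x * b - y * a = 0"
      \<comment> \<open>The square of the trace-free matrix is a^2 + b^2 times the identity, so
        applying it once more recovers \<open>x\<close> and \<open>y\<close>.\<close>
      have "(a\<^sup>2 + b\<^sup>2) * x = a * (x * a + y * b) + b * (x * b - y * a)"
        "(a\<^sup>2 + b\<^sup>2) * y = b * (x * a + y * b) - a * (x * b - y * a)" by algebra+
      then have "(a\<^sup>2 + b\<^sup>2) * x = 0" "(a\<^sup>2 + b\<^sup>2) * y = 0" using xy by simp_all
      then show "x = 0 \<and> y = 0" using ab by (auto simp: sum_power2_eq_zero_iff)
    qed
  qed
  finally show ?thesis using degenerate_at_iff[OF U p] by (simp add: a_def b_def)
qed

lemma CMC1_surface_liouville_map: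
  assumes U: "liouville_solution D U"
  shows "CMC1_surface {p\<in>D. \<not> degenerate_at U p} (liouville_map U) (liouville_normal U)"
proof -
  let ?M = "{p\<in>D. \<not> degenerate_at U p}" and ?s = "liouville_map U" and ?N = "liouville_normal U"
  let ?H = "liouville_hess U"
  have D: "open D" "smooth_on D U" using U by (auto simp: liouville_solution_def)
  \<comment> \<open>The nondegenerate points are those where this continuous function is nonzero,
    hence an open set.\<close>
  have "smooth_on D (\<lambda>p. ?H 1 1 p * ?H 1 1 p + ?H 1 2 p * ?H 1 2 p)"
    by (intro smooth_on_add smooth_on_mult smooth_on_liouville_hess D)
  from continuous_open_preimage[OF smooth_on_continuous[OF this] D(1), of "- {0}"]
  have "open {p\<in>D. ?H 1 1 p * ?H 1 1 p + ?H 1 2 p * ?H 1 2 p \<in> - {0}}"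
    by (simp add: vimage_def Int_def open_Compl)
  also have "{p\<in>D. ?H 1 1 p * ?H 1 1 p + ?H 1 2 p * ?H 1 2 p \<in> - {0}} = ?M"
    using degenerate_at_iff[OF U] by (auto simp: sum_squares_eq_zero_iff)
  finally have "open ?M" .
  have sm: "smooth_on D ?s" by (rule smooth_on_liouville_map[OF D])
  have smN: "smooth_on D ?N" unfolding liouville_normal_def[abs_def]
    by (intro smooth_on_diff smooth_on_scaleR smooth_on_exp smooth_on_divide_const smooth_on_null_lift sm D)
  have WE: "exp (U p / 2) * exp (- U p / 2) = 1" for p by (simp add: exp_add[symmetric])
  have nf: "mink (null_lift p) (?s p) = - exp (- U p / 2)" "mink (liouville_frame U i p) (?s p) = 0" for p i
    using mink_liouville_map[of U p] by (simp_all add: mink_commute)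
  have N: "mink (?N p) (?N p) = 1" "mink (?N p) (?s p) = 0" for p
    using WE[of p] unfolding liouville_normal_def mink_bilinear mink_frame nf mink_liouville_map
    by (simp_all add: algebra_simps)
  have Npd: "mink (?N p) (pd i ?s p) = 0" if "p \<in> D" for i p
    unfolding pd_liouville_map[OF D that] liouville_normal_def mink_bilinear
    by (simp add: mink_liouville_frame mink_liouville_map)
  have "mean_curvature ?s ?N p = 1" if p: "p \<in> ?M" for p
  proof -
    have pD: "p \<in> D" using p by simp
    have b: "?H 2 1 p = ?H 1 2 p" by (rule liouville_hess_commute[OF D pD])
    have tr: "?H 1 1 p + ?H 2 2 p = 0"
      using liouville_hess_trace[of U p] U pD by (simp add: liouville_solution_def)
    then have c: "?H 2 2 p = - ?H 1 1 p" by simp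
    have pdN: "pd i ?s p + pd i ?N p = exp (U p / 2) *\<^sub>R liouville_frame U i p" for i
    proof -
      have "pd i ?s p + pd i ?N p = pd i (\<lambda>x. ?s x + ?N x) p"
        using pd_add[OF smooth_on_differentiable[OF sm pD] smooth_on_differentiable[OF smN pD]] by simp
      also have "(\<lambda>x. ?s x + ?N x) = (\<lambda>p. exp (U p / 2) *\<^sub>R null_lift p)"
        by (simp add: liouville_normal_def)
      finally show ?thesis using pd_exp_half_null_lift(2)[OF smooth_on_differentiable[OF D(2) pD]] by simp
    qed
    have E: "exp (- U p / 2) \<noteq> 0" by simp
    \<comment> \<open>As the square of the trace-free matrix is scalar, the first form is a multiple
      of the identity and its determinant is the square of that multiple.\<close>
    have "mink (pd 1 ?s p) (pd 1 ?s p) * mink (pd 2 ?s p) (pd 2 ?s p) - (mink (pd 1 ?s p) (pd 2 ?s p))\<^sup>2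
      = ((exp (- U p / 2) / 2)\<^sup>2 * ((?H 1 1 p)\<^sup>2 + (?H 1 2 p)\<^sup>2))\<^sup>2"
      unfolding pd_liouville_map[OF D pD] mink_bilinear mink_liouville_frame b c
      by (simp add: power2_eq_square field_simps)
    also have "\<dots> \<noteq> 0"
      using p degenerate_at_iff[OF U pD] by (simp add: sum_power2_eq_zero_iff)
    finally have g: "mink (pd 1 ?s p) (pd 1 ?s p) * mink (pd 2 ?s p) (pd 2 ?s p) - (mink (pd 1 ?s p) (pd 2 ?s p))\<^sup>2 \<noteq> 0" .
    have "mean_curvature ?s ?N p = 1 \<longleftrightarrow> ?H 1 1 p + ?H 2 2 p = 0"
    proof (rule mean_curvature_frame[OF _ _ _ E WE _ _ g, where J="\<lambda>i j. if i = j then 1 else 0"])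
      show "pd i ?s p = (exp (- U p / 2) / 2) *\<^sub>R
        (((if 1 = i then 1 else 0) * ?H 1 1 p + (if 2 = i then 1 else 0) * ?H 1 2 p) *\<^sub>R liouville_frame U 1 p
        + ((if 1 = i then 1 else 0) * ?H 1 2 p + (if 2 = i then 1 else 0) * ?H 2 2 p) *\<^sub>R liouville_frame U 2 p)" for i
        unfolding pd_liouville_map[OF D pD] using exhaust_2[of i] b by auto
      show "pd i ?s p + pd i ?N p = exp (U p / 2) *\<^sub>R
        ((if 1 = i then 1 else 0) *\<^sub>R liouville_frame U 1 p + (if 2 = i then 1 else 0) *\<^sub>R liouville_frame U 2 p)" for i
        unfolding pdN using exhaust_2[of i] by auto
    qed (simp_all add: mink_liouville_frame)
    with tr show ?thesis by simp
  qed
  then show ?thesis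
    unfolding CMC1_surface_def immersed_surface_def
    using \<open>open ?M\<close> smooth_on_subset[OF sm, of ?M] smooth_on_subset[OF smN, of ?M] liouville_map_H3
      immersive_liouville_map_iff[OF U] N Npd
    by auto
qed

lemma pd_compose:
  fixes \<phi> :: "real^2 \<Rightarrow> real^2"
  assumes "\<phi> differentiable (at x)" "f differentiable (at (\<phi> x))"
  shows "pd i (\<lambda>x. f (\<phi> x)) x = pd i \<phi> x $ 1 *\<^sub>R pd 1 f (\<phi> x) + pd i \<phi> x $ 2 *\<^sub>R pd 2 f (\<phi> x)"
  using pd_eqI[OF has_derivative_compose[OF assms(1)[unfolded frechet_derivative_works] has_derivative_pd[OF assms(2)]]]
  by (simp add: pd_def)

section \<open>Recovering the solution from the Gauss map\<close>

text \<open>The Gauss vector is future directed: Cauchy-Schwarz for the spatial parts gives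
  \<open>1 + (v$0)\<^sup>2 \<le> 2 * (v$0 * s$0)\<close>, so \<open>v$0\<close> has the sign of
  \<open>s$0\<close>.\<close>

lemma null_time_pos:
  assumes "s \<in> H3" "mink v v = 0" "mink v s = -1"
  shows "v$0 > 0"
proof -
  let ?S = "(s$1)\<^sup>2 + (s$2)\<^sup>2 + (s$3)\<^sup>2" and ?V = "(v$1)\<^sup>2 + (v$2)\<^sup>2 + (v$3)\<^sup>2"
  let ?B = "v$1 * s$1 + v$2 * s$2 + v$3 * s$3"
  have s: "?S = (s$0)\<^sup>2 - 1" "s$0 > 0" and V: "?V = (v$0)\<^sup>2" and B: "?B = v$0 * s$0 - 1"
    using assms by (simp_all add: H3_def mink_def power2_eq_square)
  have "?V * ?S - ?B\<^sup>2 = (v$1 * s$2 - v$2 * s$1)\<^sup>2 + (v$1 * s$3 - v$3 * s$1)\<^sup>2 + (v$2 * s$3 - v$3 * s$2)\<^sup>2"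
    by algebra
  then have "?B\<^sup>2 \<le> ?V * ?S" by (smt (verit) zero_le_power2)
  then have "(v$0 * s$0 - 1)\<^sup>2 \<le> (v$0)\<^sup>2 * ((s$0)\<^sup>2 - 1)" unfolding B s V .
  then have "1 + (v$0)\<^sup>2 \<le> 2 * (v$0 * s$0)" by (simp add: power2_eq_square algebra_simps)
  then have "0 < v$0 * s$0" by (smt (verit) zero_le_power2)
  then show ?thesis using s(2) by (simp add: zero_less_mult_iff)
qed

text \<open>Minus the pairing with \<open>null_inf\<close>. It is 1 on \<open>null_lift\<close>, so
  it reads off the factor of a multiple of \<open>null_lift p\<close>.\<close>

definition null_scale :: "real^4 \<Rightarrow> real"
  where "null_scale v = v$0 + v$3"

text \<open>Homogeneous of degree zero, hence a coordinate of the ideal point spanned by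
  \<open>v\<close>.\<close>

definition null_coord :: "real^4 \<Rightarrow> real^2"
  where "null_coord v = (\<chi> i. (if i = 1 then - (v$1) else v$2) * inverse (null_scale v))"

text \<open>On the light cone \<open>(v$1)\<^sup>2 + (v$2)\<^sup>2\<close> factors as
  \<open>v$0 + v$3\<close> times \<open>v$0 - v$3\<close>; dividing by the first factor expresses
  both remaining entries through the coordinates.\<close>

lemma null_vector_eq:
  assumes "mink v v = 0" "null_scale v \<noteq> 0"
  shows "v = null_scale v *\<^sub>R null_lift (null_coord v)"
proof -
  define m where "m = null_scale v"
  have m: "m \<noteq> 0" using assms(2) by (simp add: m_def)
  have "(v$1)\<^sup>2 + (v$2)\<^sup>2 = m * (v$0 - v$3)"
    using assms(1) by (simp add: mink_def m_def null_scale_def power2_eq_square algebra_simps)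
  then have "(v$1 / m)\<^sup>2 + (v$2 / m)\<^sup>2 = (v$0 - v$3) / m"
    using m by (simp add: power_divide add_divide_distrib[symmetric] power2_eq_square)
  then have r: "(v$2 / m)\<^sup>2 = (v$0 - v$3) / m - (v$1 / m)\<^sup>2" by simp
  have *: "(v$2 * inverse m)\<^sup>2 = (v$0 - v$3) * inverse m - (v$1 * inverse m)\<^sup>2"
    using r by (simp add: divide_inverse)
  have 0: "m = v$0 + v$3" by (simp add: m_def null_scale_def)
  have "m * ((1 + t + (x * inverse m - t)) / 2) = (m + x) / 2"
    "m * ((1 - t - (x * inverse m - t)) / 2) = (m - x) / 2" for t x
    using m by (simp_all add: field_simps)
  note mx = this
  have "v$0 = m * ((1 + (v$1 * inverse m)\<^sup>2 + (v$2 * inverse m)\<^sup>2) / 2)"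
    "v$3 = m * ((1 - (v$1 * inverse m)\<^sup>2 - (v$2 * inverse m)\<^sup>2) / 2)"
    unfolding * mx unfolding 0 by simp_all
  then show ?thesis
    unfolding vec4_eq_iff null_lift_def null_coord_def m_def[symmetric]
    using m by (simp add: mult.assoc[symmetric])
qed

text \<open>Otherwise \<open>- v$3\<close> is at least \<open>v$0\<close>, so \<open>v$3\<close>
  exhausts the light cone equation, \<open>v$1\<close> and \<open>v$2\<close> vanish, and
  \<open>v\<close> spans the point at infinity.\<close>

lemma null_scale_pos:
  assumes "mink v v = 0" "v$0 > 0" "\<And>c. v \<noteq> c *\<^sub>R vec4 1 0 0 (-1)"
  shows "null_scale v > 0"
proof (rule ccontr)
  assume "\<not> null_scale v > 0"
  then have le: "v$3 \<le> - v$0" by (simp add: null_scale_def)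
  have "(v$0)\<^sup>2 = (v$1)\<^sup>2 + (v$2)\<^sup>2 + (v$3)\<^sup>2"
    using assms(1) by (simp add: mink_def power2_eq_square)
  moreover have "(v$0)\<^sup>2 \<le> (v$3)\<^sup>2"
    using power_mono[of "v$0" "- v$3" 2] le assms(2) by simp
  ultimately have "(v$1)\<^sup>2 + (v$2)\<^sup>2 \<le> 0" and eq: "(v$3)\<^sup>2 \<le> (v$0)\<^sup>2"
    using zero_le_power2[of "v$1"] zero_le_power2[of "v$2"] by linarith+
  then have "v$1 = 0" "v$2 = 0" by (simp_all add: sum_power2_le_zero_iff)
  moreover have "- v$3 \<le> v$0"
    using power2_le_imp_le[of "- v$3" "v$0"] eq assms(2) by simp
  ultimately have "v = v$0 *\<^sub>R vec4 1 0 0 (-1)" using le by (simp add: vec4_eq_iff)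
  then show False using assms(3) by blast
qed

text \<open>The difference \<open>w\<close> from the Liouville map is orthogonal to
  \<open>null_lift p\<close> and both its derivatives. These span a degenerate hyperplane whose
  orthogonal complement is the line of \<open>null_lift p\<close>, so \<open>w\<close> lies on that
  line. The norm condition is linear in the multiple \<open>k\<close>, with nonzero slope, and
  forces \<open>k = 0\<close>.\<close>

lemma liouville_map_unique:
  assumes "mink v v = -1" "mink v (null_lift p) = - exp (- U p / 2)"
    and "\<And>i. mink v (liouville_frame U i p) = 0"
  shows "v = liouville_map U p"
proof -
  define w where "w = v - liouville_map U p"
  have n: "mink w (null_lift p) = 0" and f: "mink w (liouville_frame U i p) = 0" for i
    using assms by (simp_all add: w_def mink_bilinear mink_liouville_map)
  have "mink w (null_lift_pd i p) = 0" for i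
    using f[of i] n by (simp add: liouville_frame_def mink_bilinear)
  from this[of 1] this[of 2] have w12: "w$1 = - (w$0 + w$3) * p$1" "w$2 = (w$0 + w$3) * p$2"
    by (simp_all add: mink_def null_lift_pd_def algebra_simps)
  moreover have "w$0 - w$3 = (w$0 + w$3) * ((p$1)\<^sup>2 + (p$2)\<^sup>2)"
    using n unfolding mink_def null_lift_def vec4_nth w12 by (simp add: field_simps power2_eq_square)
  ultimately have w: "w = (w$0 + w$3) *\<^sub>R null_lift p"
    by (simp add: vec4_eq_iff null_lift_def field_simps)
  define k where "k = w$0 + w$3"
  have "w = k *\<^sub>R null_lift p" using w by (simp only: k_def)
  then have v: "v = liouville_map U p + k *\<^sub>R null_lift p" by (simp add: w_def algebra_simps)
  have "mink v v = -1 - 2 * k * exp (- U p / 2)"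
    unfolding v mink_bilinear mink_liouville_map mink_frame
    by (simp add: mink_liouville_map mink_commute[of "null_lift p" "liouville_map U p"])
  then have "k = 0" using assms(1) by simp
  then show ?thesis using v by simp
qed

section \<open>CMC-1 surfaces and their Gauss map\<close>

lemma CMC1_surfaceD:
  assumes "CMC1_surface M s N"
  shows "open M" "smooth_on M s" "smooth_on M N" "\<And>p. p \<in> M \<Longrightarrow> s p \<in> H3"
    "\<And>p. p \<in> M \<Longrightarrow> immersive_at s p" "\<And>p. p \<in> M \<Longrightarrow> mink (N p) (N p) = 1"
    "\<And>p. p \<in> M \<Longrightarrow> mink (N p) (s p) = 0" "\<And>p i. p \<in> M \<Longrightarrow> mink (N p) (pd i s p) = 0"
    "\<And>p. p \<in> M \<Longrightarrow> mean_curvature s N p = 1"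
  using assms by (auto simp: CMC1_surface_def immersed_surface_def)

lemma pd_const_on:
  assumes "open M" "p \<in> M" "\<And>x. x \<in> M \<Longrightarrow> f x = c"
  shows "pd i f p = 0"
  using pd_cong_open[OF assms(1,2), of f "\<lambda>_. c"] assms(3) by (simp add: pd_def)

context
  fixes M s N assumes S: "CMC1_surface M s N"
begin

abbreviation (input) "gauss p \<equiv> s p + N p"

lemma smooth_gauss: "smooth_on M (\<lambda>p. gauss p)"
  by (intro smooth_on_add CMC1_surfaceD[OF S])

lemma gauss_differentiable:
  "p \<in> M \<Longrightarrow> (\<lambda>p. gauss p) differentiable (at p)" "p \<in> M \<Longrightarrow> s differentiable (at p)"
  "p \<in> M \<Longrightarrow> pd i s differentiable (at p)"
  using smooth_on_differentiable smooth_on_pd smooth_gauss CMC1_surfaceD[OF S] by blast+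

text \<open>Differentiating the constant pairings of s with itself and with the Gauss vector. The
  last equation is the envelope condition: the Gauss vector is orthogonal to ds, so only its own
  derivative remains in the product rule.\<close>

lemma mink_surface:
  assumes "p \<in> M"
  shows "mink (s p) (s p) = -1" "mink (s p) (pd i s p) = 0" "mink (gauss p) (gauss p) = 0"
    "mink (gauss p) (s p) = -1" "mink (gauss p) (pd i s p) = 0" "mink (pd i (\<lambda>p. gauss p) p) (s p) = 0"
proof -
  note M = CMC1_surfaceD[OF S]
  have ss: "mink (s p) (s p) = -1" if "p \<in> M" for p using M(4)[OF that] by (simp add: H3_iff)
  show "mink (s p) (s p) = -1" by (rule ss[OF assms])
  show si: "mink (s p) (pd i s p) = 0"
    using pd_const_on[OF M(1) assms, of "\<lambda>p. mink (s p) (s p)" "-1" i] ss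
      pd_mink[OF gauss_differentiable(2,2)[OF assms], of i] mink_commute[of "pd i s p" "s p"] by simp
  show "mink (gauss p) (gauss p) = 0" "mink (gauss p) (pd i s p) = 0"
    using M(6-8)[OF assms] ss[OF assms] si by (simp_all add: mink_bilinear mink_commute[of "s p" "N p"])
  have gs: "mink (gauss p) (s p) = -1" if "p \<in> M" for p
    using M(7)[OF that] ss[OF that] by (simp add: mink_bilinear)
  show "mink (gauss p) (s p) = -1" by (rule gs[OF assms])
  show "mink (pd i (\<lambda>p. gauss p) p) (s p) = 0"
    using pd_const_on[OF M(1) assms, of "\<lambda>p. mink (gauss p) (s p)" "-1" i] gs
      pd_mink[OF gauss_differentiable(1,2)[OF assms], of i] \<open>mink (gauss p) (pd i s p) = 0\<close> by simp
qed

lemma pd_gauss: "p \<in> M \<Longrightarrow> pd i (\<lambda>p. gauss p) p = pd i s p + pd i N p"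
  using pd_add smooth_on_differentiable CMC1_surfaceD[OF S] by blast

text \<open>Differentiating the orthogonality of s + N and ds gives minus the pairing of s + N with
  a second derivative of s, which is symmetric.\<close>

lemma mixed_form_symmetric:
  assumes "p \<in> M"
  shows "mixed_form s N i j p = mixed_form s N j i p"
proof -
  note M = CMC1_surfaceD[OF S]
  have "mixed_form s N i j p = - mink (gauss p) (pd i (pd j s) p)" for i j
    using pd_const_on[OF M(1) assms, of "\<lambda>p. mink (gauss p) (pd j s p)" 0 i] mink_surface(5)
      pd_mink[OF gauss_differentiable(1,3)[OF assms], of i j] pd_gauss[OF assms]
    by (simp add: mixed_form_def)
  then show ?thesis using pd_commute[OF M(1) assms M(2), of i j] by simp
qed

lemma first_form_pos:
  assumes "p \<in> M"
  shows "mink (pd 1 s p) (pd 1 s p) > 0"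
    and "mink (pd 1 s p) (pd 1 s p) * mink (pd 2 s p) (pd 2 s p) - (mink (pd 1 s p) (pd 2 s p))\<^sup>2 > 0"
proof -
  note M = CMC1_surfaceD[OF S]
  let ?a = "mink (pd 1 s p) (pd 1 s p)" and ?b = "mink (pd 1 s p) (pd 2 s p)"
  have pos: "mink v v > 0" if "v = x *\<^sub>R pd 1 s p + y *\<^sub>R pd 2 s p" "x \<noteq> 0 \<or> y \<noteq> 0" for v x y
  proof (rule H3_tangent_pos[OF M(4)[OF assms]])
    show "mink v (s p) = 0"
      using mink_surface(2)[OF assms] by (simp add: that(1) mink_bilinear mink_commute[of _ "s p"])
    show "v \<noteq> 0"
      using M(5)[OF assms] inj_frechet_derivative_iff[OF gauss_differentiable(2)[OF assms]] that
      by (auto simp: immersive_at_def)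
  qed
  show a: "?a > 0" using pos[of "pd 1 s p" 1 0] by simp
  \<comment> \<open>The Gram-Schmidt vector orthogonal to \<open>pd 1 s p\<close>, scaled by
    \<open>?a\<close> to avoid division; its norm is \<open>?a\<close> times the
    determinant.\<close>
  let ?v = "(- ?b) *\<^sub>R pd 1 s p + ?a *\<^sub>R pd 2 s p"
  have "mink ?v ?v = ?a * (?a * mink (pd 2 s p) (pd 2 s p) - ?b\<^sup>2)"
    unfolding mink_bilinear mink_commute[of "pd 2 s p" "pd 1 s p"] by (simp add: algebra_simps power2_eq_square)
  moreover have "mink ?v ?v > 0" by (rule pos[OF refl]) (use a in simp)
  ultimately show "?a * mink (pd 2 s p) (pd 2 s p) - ?b\<^sup>2 > 0" using a by (simp add: zero_less_mult_iff)
qed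

text \<open>If the determinant vanished, the trace condition would make a definite form
  vanish at each row of the symmetric matrix.\<close>

lemma mixed_form_det:
  assumes "p \<in> M" "\<not> umbilic s N p"
  shows "mixed_form s N 1 1 p * mixed_form s N 2 2 p - mixed_form s N 1 2 p * mixed_form s N 2 1 p \<noteq> 0"
proof
  define a b c where "a = mink (pd 1 s p) (pd 1 s p)" and "b = mink (pd 1 s p) (pd 2 s p)"
    and "c = mink (pd 2 s p) (pd 2 s p)"
  define x y z where "x = mixed_form s N 1 1 p" and "y = mixed_form s N 1 2 p" and "z = mixed_form s N 2 2 p"
  have y: "mixed_form s N 2 1 p = y" using mixed_form_symmetric[OF assms(1)] by (simp add: y_def)
  have pos: "a > 0" "a * c - b\<^sup>2 > 0" using first_form_pos[OF assms(1)] by (simp_all add: a_def b_def c_def)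
  have tr: "c * x - b * (y + y) + a * z = 0"
    using mean_curvature_eq_1_iff[of s p N] pos(2) CMC1_surfaceD(9)[OF S assms(1)] y
    by (simp add: a_def b_def c_def x_def y_def z_def)
  assume "mixed_form s N 1 1 p * mixed_form s N 2 2 p - mixed_form s N 1 2 p * mixed_form s N 2 1 p = 0"
  then have det: "x * z = y\<^sup>2" using y by (simp add: x_def y_def z_def power2_eq_square)
  have def0: "u = 0 \<and> v = 0" if "c * u\<^sup>2 - 2 * b * u * v + a * v\<^sup>2 = 0" for u v
  proof -
    \<comment> \<open>Completing the square shows that the adjugate form is definite.\<close>
    have "(a * v - b * u)\<^sup>2 + (a * c - b\<^sup>2) * u\<^sup>2 = a * (c * u\<^sup>2 - 2 * b * u * v + a * v\<^sup>2)" by algebra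
    then have 0: "(a * v - b * u)\<^sup>2 + (a * c - b\<^sup>2) * u\<^sup>2 = 0" using that by simp
    moreover have "(a * c - b\<^sup>2) * u\<^sup>2 \<ge> 0" using pos(2) by simp
    ultimately have "(a * c - b\<^sup>2) * u\<^sup>2 = 0" "(a * v - b * u)\<^sup>2 = 0"
      using zero_le_power2[of "a * v - b * u"] by linarith+
    then show ?thesis using pos by auto
  qed
  \<comment> \<open>Replacing \<open>y\<^sup>2\<close> by \<open>x * z\<close> turns the definite
    form at the row \<open>x, y\<close> into \<open>x\<close> times the trace condition.\<close>
  have "c * x\<^sup>2 - 2 * b * x * y + a * y\<^sup>2 = x * (c * x - b * (y + y) + a * z)"
    unfolding det[symmetric] by (simp add: algebra_simps power2_eq_square)
  then have xy: "x = 0 \<and> y = 0" using def0[of x y] tr by simp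
  then have "z = 0" using tr pos(1) by simp
  have T: "mixed_form s N i j p = 0" for i j
    using xy \<open>z = 0\<close> y exhaust_2[of i] exhaust_2[of j] by (auto simp: x_def y_def z_def)
  have "second_form s N p $ i $ j = first_form s p $ i $ j" for i j
    using T[of i j] by (simp add: mixed_form_def second_form_def first_form_def mink_bilinear)
  then have "second_form s N p = 1 *\<^sub>R first_form s p" by (simp add: vec_eq_iff)
  then show False using assms(2) unfolding umbilic_def by blast
qed

lemma locally_liouville_off_infinity:
  assumes p: "p \<in> M" and "\<not> umbilic s N p" and "\<not> gauss_at_infinity s N p"
  shows "locally_liouville M s p"
proof -
  note M = CMC1_surfaceD[OF S]
  define G where "G = (\<lambda>p. gauss p)"
  define \<mu> where "\<mu> q = null_scale (G q)" for q
  define \<phi> where "\<phi> q = null_coord (G q)" for q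
  have smG: "smooth_on M G" unfolding G_def by (rule smooth_gauss)
  have dG: "G differentiable (at q)" if "q \<in> M" for q by (rule smooth_on_differentiable[OF smG that])
  have sm\<mu>: "smooth_on M \<mu>" unfolding \<mu>_def[abs_def] null_scale_def
    by (intro smooth_on_add smooth_on_nth M(1) smG)
  have "open {q\<in>M. \<mu> q > 0}"
    using continuous_open_preimage[OF smooth_on_continuous[OF sm\<mu>] M(1), of "{0<..}"]
    by (simp add: vimage_def Int_def)
  \<comment> \<open>An open condition that keeps the Gauss image off infinity and makes the
    logarithm of \<mu> available.\<close>
  define M0 where "M0 = {q\<in>M. \<mu> q > 0}"
  have M0: "open M0" "M0 \<subseteq> M" "\<And>q. q \<in> M0 \<Longrightarrow> \<mu> q > 0"
    using \<open>open {q\<in>M. \<mu> q > 0}\<close> by (auto simp: M0_def)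
  have "G p $ 0 > 0"
    unfolding G_def using null_time_pos[OF M(4)[OF p] mink_surface(3,4)[OF p]] by simp
  then have "\<mu> p > 0" unfolding \<mu>_def
    using null_scale_pos[of "G p"] mink_surface(3)[OF p] assms(3) by (auto simp: gauss_at_infinity_def G_def)
  then have "p \<in> M0" using p by (simp add: M0_def)
  have G: "G q = \<mu> q *\<^sub>R null_lift (\<phi> q)" if "q \<in> M0" for q
    unfolding \<mu>_def \<phi>_def
    by (rule null_vector_eq) (use mink_surface(3)[of q] M0 that in \<open>auto simp: G_def \<mu>_def\<close>, force)
  have sm\<phi>: "smooth_on M0 \<phi>"
  proof (rule smooth_on_vec[OF M0(1)])
    have "smooth_on M0 (\<lambda>q. inverse (\<mu> q))" and "smooth_on M0 (\<lambda>q. G q $ k)" for k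
      using smooth_on_inverse[OF M0(1) smooth_on_subset[OF sm\<mu> M0(2)]] M0(3)
        smooth_on_nth[OF M0(1) smooth_on_subset[OF smG M0(2)]] by force+
    then show "smooth_on M0 (\<lambda>q. \<phi> q $ i)" for i
      by (cases "i = 1") (simp_all add: \<phi>_def[abs_def] null_coord_def \<mu>_def[symmetric] smooth_on_mult smooth_on_minus M0(1)
          del: mult_minus_left)
  qed
  have pdG: "pd i G q = pd i \<mu> q *\<^sub>R null_lift (\<phi> q)
      + \<mu> q *\<^sub>R (pd i \<phi> q $ 1 *\<^sub>R null_lift_pd 1 (\<phi> q) + pd i \<phi> q $ 2 *\<^sub>R null_lift_pd 2 (\<phi> q))"
    if "q \<in> M0" for i q
  proof -
    have "pd i G q = pd i (\<lambda>q. \<mu> q *\<^sub>R null_lift (\<phi> q)) q"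
      by (rule pd_cong_open[OF M0(1) that]) (rule G)
    also have "\<dots> = pd i \<mu> q *\<^sub>R null_lift (\<phi> q)
      + \<mu> q *\<^sub>R (pd i \<phi> q $ 1 *\<^sub>R null_lift_pd 1 (\<phi> q) + pd i \<phi> q $ 2 *\<^sub>R null_lift_pd 2 (\<phi> q))"
      using pd_eqI[OF has_derivative_scaleR[OF
            smooth_on_differentiable[OF sm\<mu>, of q, unfolded frechet_derivative_works]
            has_derivative_compose[OF smooth_on_differentiable[OF sm\<phi> that, unfolded frechet_derivative_works]
              has_derivative_frame(1)]]] that M0(2)
      by (auto simp: pd_def)
    finally show ?thesis .
  qed
  \<comment> \<open>The \<open>null_lift\<close> part of dG is orthogonal to ds, so the mixed form
    is \<mu> times the transposed Jacobian of \<phi> times the matrix \<open>m\<close>. A vanishing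
    Jacobian would contradict \<open>mixed_form_det\<close>.\<close>
  have "jac_det \<phi> p \<noteq> 0"
  proof
    assume jac: "jac_det \<phi> p = 0"
    define m where "m a j = mink (null_lift_pd a (\<phi> p)) (pd j s p)" for a j
    have "\<mu> p * mink (null_lift (\<phi> p)) (pd j s p) = mink (G p) (pd j s p)" for j
      unfolding G[OF \<open>p \<in> M0\<close>] by (simp add: mink_bilinear)
    then have "\<mu> p * mink (null_lift (\<phi> p)) (pd j s p) = 0" for j
      using mink_surface(5)[OF p, of j] by (simp add: G_def)
    then have n: "mink (null_lift (\<phi> p)) (pd j s p) = 0" for j using \<open>\<mu> p > 0\<close> by simp
    have T: "mixed_form s N i j p = \<mu> p * (pd i \<phi> p $ 1 * m 1 j + pd i \<phi> p $ 2 * m 2 j)" for i j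
      unfolding mixed_form_def pd_gauss[OF p, symmetric]
      unfolding G_def[symmetric] pdG[OF \<open>p \<in> M0\<close>] mink_bilinear n m_def by simp
    have "mixed_form s N 1 1 p * mixed_form s N 2 2 p - mixed_form s N 1 2 p * mixed_form s N 2 1 p
      = (\<mu> p)\<^sup>2 * jac_det \<phi> p * (m 1 1 * m 2 2 - m 1 2 * m 2 1)"
      unfolding T jac_det_def by algebra
    then show False using mixed_form_det[OF p assms(2)] jac by simp
  qed
  from smooth_local_inverse[OF M0(1) sm\<phi> \<open>p \<in> M0\<close> this]
  obtain V where V: "p \<in> V" "V \<subseteq> M0" "diffeo_betw \<phi> V (\<phi> ` V)" by metis
  define D where "D = \<phi> ` V"
  define \<psi> where "\<psi> = inv_into V \<phi>"
  have D: "open V" "open D" "smooth_on V \<phi>" "smooth_on D \<psi>" "bij_betw \<phi> V D"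
    using V(3) by (auto simp: diffeo_betw_def D_def \<psi>_def)
  have \<psi>: "\<psi> u \<in> V" "\<phi> (\<psi> u) = u" if "u \<in> D" for u
    using that by (auto simp: \<psi>_def D_def inv_into_into f_inv_into_f)
  have \<psi>\<phi>: "\<psi> (\<phi> q) = q" "\<phi> q \<in> D" if "q \<in> V" for q
    using that D(5) by (auto simp: \<psi>_def D_def bij_betw_def)
  have \<psi>M: "\<psi> u \<in> M0" "\<psi> u \<in> M" if "u \<in> D" for u using \<psi>(1)[OF that] V(2) M0(2) by auto
  \<comment> \<open>Chosen so that exp(U/2) is the scale of the Gauss vector in Gauss
    coordinates.\<close>
  define U where "U u = 2 * ln (\<mu> (\<psi> u))" for u
  have W: "exp (U u / 2) = \<mu> (\<psi> u)" if "u \<in> D" for u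
    using M0(3)[OF \<psi>M(1)[OF that]] by (simp add: U_def)
  have smU: "smooth_on D U" unfolding U_def[abs_def]
    using M0(3) \<psi>M
    by (intro smooth_on_mult smooth_on_const smooth_on_ln smooth_on_compose[OF D(2) _ D(4) sm\<mu>] D) auto
  note dU = smooth_on_differentiable[OF smU]
  let ?f = "liouville_map U"
  have G\<psi>: "G (\<psi> u) = exp (U u / 2) *\<^sub>R null_lift u" if "u \<in> D" for u
    using G[OF \<psi>M(1)[OF that]] W[OF that] \<psi>(2)[OF that] by simp
  have WE: "exp (U u / 2) * exp (- U u / 2) = 1" for u by (simp add: exp_add[symmetric])
  have eq: "s (\<psi> u) = ?f u" if u: "u \<in> D" for u
  proof (rule liouville_map_unique)
    show "mink (s (\<psi> u)) (s (\<psi> u)) = -1" by (rule mink_surface(1)[OF \<psi>M(2)[OF u]])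
    have "mink (G (\<psi> u)) (s (\<psi> u)) = -1"
      using mink_surface(4)[OF \<psi>M(2)[OF u]] by (simp add: G_def)
    then have "exp (U u / 2) * mink (s (\<psi> u)) (null_lift u) = -1"
      unfolding G\<psi>[OF u] by (simp add: mink_bilinear mink_commute[of "null_lift u"])
    then have "exp (U u / 2) * (mink (s (\<psi> u)) (null_lift u) + exp (- U u / 2)) = 0"
      using WE[of u] by (simp add: distrib_left)
    then show "mink (s (\<psi> u)) (null_lift u) = - exp (- U u / 2)" by simp
    fix i
    \<comment> \<open>The envelope condition in Gauss coordinates: the frame vector is a multiple of
      a derivative of \<open>G\<close> along \<psi>, and all derivatives of \<open>G\<close> are
      orthogonal to \<open>s\<close>.\<close>
    have "exp (U u / 2) *\<^sub>R liouville_frame U i u = pd i (\<lambda>u. exp (U u / 2) *\<^sub>R null_lift u) u"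
      using pd_exp_half_null_lift(2)[OF dU[OF u]] by simp
    also have "\<dots> = pd i (\<lambda>u. G (\<psi> u)) u" by (rule pd_cong_open[OF D(2) u]) (rule G\<psi>[symmetric])
    also have "\<dots> = pd i \<psi> u $ 1 *\<^sub>R pd 1 G (\<psi> u) + pd i \<psi> u $ 2 *\<^sub>R pd 2 G (\<psi> u)"
      by (rule pd_compose[OF smooth_on_differentiable[OF D(4) u] dG[OF \<psi>M(2)[OF u]]])
    finally have "mink (exp (U u / 2) *\<^sub>R liouville_frame U i u) (s (\<psi> u))
      = mink (pd i \<psi> u $ 1 *\<^sub>R pd 1 G (\<psi> u) + pd i \<psi> u $ 2 *\<^sub>R pd 2 G (\<psi> u)) (s (\<psi> u))" by simp
    moreover have "mink (pd j G (\<psi> u)) (s (\<psi> u)) = 0" for j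
      unfolding G_def by (rule mink_surface(6)[OF \<psi>M(2)[OF u]])
    ultimately have "mink (liouville_frame U i u) (s (\<psi> u)) = 0" by (simp add: mink_bilinear)
    then show "mink (s (\<psi> u)) (liouville_frame U i u) = 0" by (simp add: mink_commute)
  qed
  have s: "s q = ?f (\<phi> q)" if "q \<in> V" for q using eq[OF \<psi>\<phi>(2)[OF that]] \<psi>\<phi>(1)[OF that] by simp
  \<comment> \<open>Mean curvature one is given in the parameters of \<open>s\<close>, so
    \<open>mean_curvature_frame\<close> is applied with the Jacobian of \<phi>; it yields a
    trace-free \<open>liouville_hess\<close>.\<close>
  have "pd 1 (pd 1 U) u + pd 2 (pd 2 U) u + 2 * exp (U u) = 0" if u: "u \<in> D" for u
  proof -
    define q where "q = \<psi> u"
    have q: "q \<in> V" "\<phi> q = u" "q \<in> M" using \<psi>[OF u] \<psi>M[OF u] by (auto simp: q_def)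
    have d\<phi>: "\<phi> differentiable (at q)" by (rule smooth_on_differentiable[OF D(3) q(1)])
    have pds: "pd i s q = pd i \<phi> q $ 1 *\<^sub>R pd 1 ?f u + pd i \<phi> q $ 2 *\<^sub>R pd 2 ?f u" for i
    proof -
      have "pd i s q = pd i (\<lambda>q. ?f (\<phi> q)) q" by (rule pd_cong_open[OF D(1) q(1) s])
      also have "\<dots> = pd i \<phi> q $ 1 *\<^sub>R pd 1 ?f u + pd i \<phi> q $ 2 *\<^sub>R pd 2 ?f u"
        using pd_compose[OF d\<phi>, of ?f i] smooth_on_differentiable[OF smooth_on_liouville_map[OF D(2) smU] u]
        by (simp add: q(2))
      finally show ?thesis .
    qed
    let ?g = "\<lambda>u. exp (U u / 2) *\<^sub>R null_lift u"
    have pdG': "pd i G q = pd i \<phi> q $ 1 *\<^sub>R pd 1 ?g u + pd i \<phi> q $ 2 *\<^sub>R pd 2 ?g u" for i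
    proof -
      have Gg: "G q = ?g (\<phi> q)" if "q \<in> V" for q using G\<psi>[OF \<psi>\<phi>(2)[OF that]] \<psi>\<phi>(1)[OF that] by simp
      have "pd i G q = pd i (\<lambda>q. ?g (\<phi> q)) q" by (rule pd_cong_open[OF D(1) q(1) Gg])
      also have "\<dots> = pd i \<phi> q $ 1 *\<^sub>R pd 1 ?g u + pd i \<phi> q $ 2 *\<^sub>R pd 2 ?g u"
        using pd_compose[OF d\<phi>, of ?g i] pd_exp_half_null_lift(1)[OF dU[OF u]]
        by (auto simp: q(2) differentiable_def)
      finally show ?thesis .
    qed
    have b: "liouville_hess U 2 1 u = liouville_hess U 1 2 u" by (rule liouville_hess_commute[OF D(2) smU u])
    have "mean_curvature s N q = 1 \<longleftrightarrow> liouville_hess U 1 1 u + liouville_hess U 2 2 u = 0"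
    proof (rule mean_curvature_frame[where J="\<lambda>a i. pd i \<phi> q $ a" and E="exp (- U u / 2)" and W="exp (U u / 2)"
          and ?e1.0="liouville_frame U 1 u" and ?e2.0="liouville_frame U 2 u" and b="liouville_hess U 1 2 u"])
      show "pd i s q = (exp (- U u / 2) / 2) *\<^sub>R
        ((pd i \<phi> q $ 1 * liouville_hess U 1 1 u + pd i \<phi> q $ 2 * liouville_hess U 1 2 u) *\<^sub>R liouville_frame U 1 u
        + (pd i \<phi> q $ 1 * liouville_hess U 1 2 u + pd i \<phi> q $ 2 * liouville_hess U 2 2 u) *\<^sub>R liouville_frame U 2 u)" for i
        unfolding pds pd_liouville_map[OF D(2) smU u] b by (simp add: algebra_simps)
      show "pd i s q + pd i N q = exp (U u / 2) *\<^sub>R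
        (pd i \<phi> q $ 1 *\<^sub>R liouville_frame U 1 u + pd i \<phi> q $ 2 *\<^sub>R liouville_frame U 2 u)" for i
        unfolding pd_gauss[OF q(3), symmetric] unfolding G_def[symmetric] pdG' pd_exp_half_null_lift(2)[OF dU[OF u]]
        by (simp add: algebra_simps)
      show "mink (pd 1 s q) (pd 1 s q) * mink (pd 2 s q) (pd 2 s q) - (mink (pd 1 s q) (pd 2 s q))\<^sup>2 \<noteq> 0"
        using first_form_pos(2)[OF q(3)] by simp
    qed (simp_all add: mink_liouville_frame mult_exp_exp)
    then show ?thesis using M(9)[OF q(3)] liouville_hess_trace[of U u] by simp
  qed
  then have "liouville_solution D U" using D(2) smU by (simp add: liouville_solution_def)
  then show ?thesis unfolding locally_liouville_def
    using V D_def s M0(2) by (intro exI[of _ V] exI[of _ D] exI[of _ U] exI[of _ \<phi>]) auto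
qed

end

section \<open>Isometries\<close>

lemma H3_isometry_eq_0:
  assumes "H3_isometry L" "L v = 0"
  shows "v = 0"
proof -
  \<comment> \<open>Flipping the sign of the time entry turns the Minkowski pairing with
    \<open>v\<close> into the Euclidean norm.\<close>
  let ?w = "vec4 (- v$0) (v$1) (v$2) (v$3)"
  have "mink v ?w = mink (L v) (L ?w)" using assms(1) by (simp add: H3_isometry_def)
  then have "(v$0)\<^sup>2 + (v$1)\<^sup>2 + (v$2)\<^sup>2 + (v$3)\<^sup>2 = 0"
    using assms(2) by (simp add: mink_bilinear) (simp add: mink_def power2_eq_square)
  then have "(v$0)\<^sup>2 = 0" "(v$1)\<^sup>2 = 0" "(v$2)\<^sup>2 = 0" "(v$3)\<^sup>2 = 0"
    using zero_le_power2[of "v$0"] zero_le_power2[of "v$1"] zero_le_power2[of "v$2"] zero_le_power2[of "v$3"]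
    by linarith+
  then show ?thesis by (simp add: vec4_eq_iff)
qed

lemma H3_isometry_forms:
  assumes L: "H3_isometry L" and "s differentiable (at p)" "N differentiable (at p)"
  shows "first_form (L \<circ> s) p = first_form s p" "second_form (L \<circ> s) (L \<circ> N) p = second_form s N p"
proof -
  have bl: "bounded_linear L" using L by (simp add: H3_isometry_def linear_conv_bounded_linear)
  have "mink (L v) (L w) = mink v w" for v w using L by (simp add: H3_isometry_def)
  then show "first_form (L \<circ> s) p = first_form s p" "second_form (L \<circ> s) (L \<circ> N) p = second_form s N p"
    by (simp_all add: first_form_def second_form_def o_def pd_linear[OF bl] assms(2,3))
qed

text \<open>The normal is transported along with the surface, so the sign of the mean curvature
  survives even under orientation-reversing isometries.\<close>

lemma CMC1_surface_isometry:
  assumes L: "H3_isometry L" and S: "CMC1_surface M s N"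
  shows "CMC1_surface M (L \<circ> s) (L \<circ> N)"
proof -
  note M = CMC1_surfaceD[OF S]
  have bl: "bounded_linear L" and mink: "mink (L v) (L w) = mink v w" and H3: "L ` H3 = H3" for v w
    using L by (auto simp: H3_isometry_def linear_conv_bounded_linear)
  have d: "s differentiable (at p)" "N differentiable (at p)" if "p \<in> M" for p
    using smooth_on_differentiable M(2,3) that by blast+
  have sm: "smooth_on M (L \<circ> s)" "smooth_on M (L \<circ> N)"
    using smooth_on_linear[OF M(1) bl M(2)] smooth_on_linear[OF M(1) bl M(3)] by (simp_all add: o_def)
  have pd: "pd i (L \<circ> s) p = L (pd i s p)" if "p \<in> M" for i p
    unfolding o_def using pd_linear[OF bl d(1)[OF that]] .
  have "immersive_at (L \<circ> s) p" if p: "p \<in> M" for p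
  proof -
    have "L (a *\<^sub>R pd 1 s p + b *\<^sub>R pd 2 s p) = a *\<^sub>R pd 1 (L \<circ> s) p + b *\<^sub>R pd 2 (L \<circ> s) p" for a b
      unfolding pd[OF p] using L by (simp add: H3_isometry_def linear_add linear_scale)
    then show ?thesis
      using M(5)[OF p] H3_isometry_eq_0[OF L] smooth_on_differentiable[OF sm(1) p] d(1)[OF p]
      by (simp add: immersive_at_def inj_frechet_derivative_iff) metis
  qed
  moreover have "mean_curvature (L \<circ> s) (L \<circ> N) p = 1" if "p \<in> M" for p
    using M(9)[OF that] H3_isometry_forms[OF L d[OF that]] by (simp add: mean_curvature_def)
  ultimately show ?thesis
    unfolding CMC1_surface_def immersed_surface_def
    using M H3 sm pd mink by auto
qed

lemma H3_isometry_id: "H3_isometry id"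
  by (simp add: H3_isometry_def linear_id)

text \<open>Exchanges the point at infinity with the ideal point of
  \<open>null_lift 0\<close>.\<close>

definition reflect3 :: "real^4 \<Rightarrow> real^4"
  where "reflect3 v = vec4 (v$0) (v$1) (v$2) (- (v$3))"

lemma H3_isometry_reflect3: "H3_isometry reflect3"
proof -
  have inv: "reflect3 (reflect3 v) = v" for v by (simp add: reflect3_def vec4_eq_iff)
  have H3: "reflect3 v \<in> H3" if "v \<in> H3" for v using that by (simp add: reflect3_def H3_def)
  have "reflect3 ` H3 = H3"
  proof
    show "H3 \<subseteq> reflect3 ` H3" using H3 inv by (metis image_eqI subsetI)
  qed (use H3 in auto)
  moreover have "linear reflect3" by (rule linearI) (simp_all add: reflect3_def vec4_eq_iff)
  ultimately show ?thesis by (simp add: H3_isometry_def reflect3_def mink_def)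
qed

lemma locally_liouville_isometry:
  assumes S: "CMC1_surface M s N" and p: "p \<in> M" and "\<not> umbilic s N p"
  shows "\<exists>L. H3_isometry L \<and> locally_liouville M (L \<circ> s) p"
proof (cases "gauss_at_infinity s N p")
  case False
  then show ?thesis
    using locally_liouville_off_infinity[OF S p assms(3)] H3_isometry_id by (metis id_comp)
next
  case True
  then obtain c where c: "s p + N p = c *\<^sub>R vec4 1 0 0 (-1)" by (auto simp: gauss_at_infinity_def)
  note M = CMC1_surfaceD[OF S]
  have "(s p + N p) $ 0 > 0"
    using null_time_pos[OF M(4)[OF p] mink_surface(3,4)[OF S p]] .
  \<comment> \<open>Only the zero vector lies on the line at infinity both before and after the
    reflection; future-directedness of the Gauss vector excludes it.\<close>
  then have "c > 0" by (simp add: c)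
  have "\<not> gauss_at_infinity (reflect3 \<circ> s) (reflect3 \<circ> N) p"
  proof
    assume "gauss_at_infinity (reflect3 \<circ> s) (reflect3 \<circ> N) p"
    then obtain c' where c': "reflect3 (s p) + reflect3 (N p) = c' *\<^sub>R vec4 1 0 0 (-1)"
      by (auto simp: gauss_at_infinity_def)
    have "reflect3 (s p) + reflect3 (N p) = reflect3 (s p + N p)" by (simp add: reflect3_def vec4_eq_iff)
    then show False using c c' \<open>c > 0\<close> by (simp add: reflect3_def vec4_eq_iff)
  qed
  moreover have "\<not> umbilic (reflect3 \<circ> s) (reflect3 \<circ> N) p"
    using assms(3) H3_isometry_forms[OF H3_isometry_reflect3] smooth_on_differentiable M(2,3) p
    by (metis umbilic_def)
  ultimately show ?thesis
    using locally_liouville_off_infinity[OF CMC1_surface_isometry[OF H3_isometry_reflect3 S] p]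
      H3_isometry_reflect3 by blast
qed

theorem theorem1p1:
  shows "(\<forall>D U. liouville_solution D U \<longrightarrow>
            liouville_map U ` D \<subseteq> H3 \<and>
            (\<forall>p\<in>D. immersive_at (liouville_map U) p \<longleftrightarrow> \<not> degenerate_at U p) \<and>
            (\<exists>N. CMC1_surface {p\<in>D. \<not> degenerate_at U p} (liouville_map U) N)) \<and>
         (\<forall>M s N p. CMC1_surface M s N \<and> p \<in> M \<and> \<not> umbilic s N p \<longrightarrow>
            (\<not> gauss_at_infinity s N p \<longrightarrow> locally_liouville M s p) \<and>
            (\<exists>L. H3_isometry L \<and> locally_liouville M (L \<circ> s) p))"
proof (intro conjI allI impI; (elim conjE)?)
  fix D U assume U: "liouville_solution D U"
  show "liouville_map U ` D \<subseteq> H3" using liouville_map_H3 by blast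
  show "\<forall>p\<in>D. immersive_at (liouville_map U) p \<longleftrightarrow> \<not> degenerate_at U p"
    using immersive_liouville_map_iff[OF U] by blast
  show "\<exists>N. CMC1_surface {p\<in>D. \<not> degenerate_at U p} (liouville_map U) N"
    using CMC1_surface_liouville_map[OF U] by blast
next
  fix M s N p
  assume S: "CMC1_surface M s N" "p \<in> M" "\<not> umbilic s N p"
  show "\<exists>L. H3_isometry L \<and> locally_liouville M (L \<circ> s) p"
    by (rule locally_liouville_isometry[OF S])
  assume "\<not> gauss_at_infinity s N p"
  then show "locally_liouville M s p" by (rule locally_liouville_off_infinity[OF S])
qed

end
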